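(* Fix $N\ge1$, $L>0$ and $\lambda>0$, and let $I=\{0,1,\dots,N,*\}$. Then $\mathrm{val}(\mathrm{PEP})=\mathrm{val}(\overline{\mathrm{PEP}})$, and this common value equals the optimal value of the semidefinite program (SDP) described below.
   Context: $\mathcal{B}_L(\mathbb{R}^n)$ is the set of pairs $f,h:\mathbb{R}^n\to\mathbb{R}$ such that $f$ is convex, differentiable and has at least one minimizer; $h$ is strictly convex and differentiable; $Lh-f$ is convex; and for every $\lambda'>0$, $x,p\in\mathbb{R}^n$ the function $u\mapsto\langle p,u-x\rangle+\frac1{\lambda'}D_h(u,x)$ has a unique minimizer, with $D_h(u,x)=h(u)-h(x)-\langle\nabla h(x),u-x\rangle$. (PEP) is the supremum of $\big(f(x_N)-f(x_* )\big)/D_h(x_*,x_0)$ (with convention $0/0=0$) over all $n\ge1$, $(f,h)\in\mathcal{B}_L(\mathbb{R}^n)$, $x_0\in\mathbb{R}^n$, minimizers $x_*$ of $f$, where $x_1,\dots,x_N$ are the NoLips iterates $x_{k+1}=\operatorname{argmin}_u\langle\nabla f(x_k),u-x_k\rangle+\frac1\lambda D_h(u,x_k)$. $(\overline{\mathrm{PEP}})$ is the supremum of $f_N-f_*$ over all $n\ge1$ and $\{(x_i,f_i,g_i,h_i,s_i)\}_{i\in I}\subset(\mathbb{R}^n\times\mathbb{R}\times\mathbb{R}^n\times\mathbb{R}\times\mathbb{R}^n)$ such that: there exist $f,h:\mathbb{R}^n\to\mathbb{R}$ with $f$ and $Lh-f$ convex and $f_i=f(x_i)$, $g_i\in\partial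 f(x_i)$, $h_i=h(x_i)$, $s_i\in\partial h(x_i)$, $Ls_i-g_i\in\partial(Lh-f)(x_i)$ for all $i\in I$; $g_*=0$; $s_{i+1}=s_i-\lambda g_i$ for $i\in\{0,\dots,N-1\}$; and $h_*-h_0-\langle s_0,x_*-x_0\rangle=1$. (SDP) is: maximize $f_N-f_*$ over $F=(f_0,\dots,f_N,f_* )\in\mathbb{R}^{N+2}$, $H=(h_0,\dots,h_N,h_* )\in\mathbb{R}^{N+2}$ and a symmetric positive semidefinite matrix $G$ of size $3(N+2)$ whose rows/columns are indexed by pairs $(a,i)$ with $a\in\{x,g,s\}$, $i\in I$ (write $G^{ab}_{ij}$ for the entry at $((a,i),(b,j))$), subject to: for all $i,j\in I$, $f_i-f_j-G^{gx}_{ji}+G^{gx}_{jj}\ge0$ and $(Lh_i-f_i)-(Lh_j-f_j)-L(G^{sx}_{ji}-G^{sx}_{jj})+G^{gx}_{ji}-G^{gx}_{jj}\ge0$; $G^{gg}_{**}=0$; $G^{sx}_{i+1,j}=G^{sx}_{ij}-\lambda G^{gx}_{ij}$ for $i\in\{0,\dots,N-1\}$, $j\in I$; and $h_*-h_0-G^{sx}_{0*}+G^{sx}_{00}=1$. *)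

theory Defs
  imports "HOL-Analysis.Analysis"
begin

text \<open>The dimension n varies inside the suprema, so R^n is represented as the set
of real sequences vanishing from index n on, with the standard inner product.\<close>

type_synonym vect = "nat \<Rightarrow> real"

definition Rn :: "nat \<Rightarrow> vect set" where
  "Rn n = {x. \<forall>i\<ge>n. x i = 0}"

definition ip :: "nat \<Rightarrow> vect \<Rightarrow> vect \<Rightarrow> real" where
  "ip n x y = (\<Sum>i<n. x i * y i)"

definition vnorm :: "nat \<Rightarrow> vect \<Rightarrow> real" where
  "vnorm n x = sqrt (ip n x x)"

definition vsub :: "vect \<Rightarrow> vect \<Rightarrow> vect" where
  "vsub x y = (\<lambda>i. x i - y i)"

definition vzero :: vect where
  "vzero = (\<lambda>i. 0)"

definition cvx :: "nat \<Rightarrow> (vect \<Rightarrow> real) \<Rightarrow> bool" where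
  "cvx n f \<longleftrightarrow> (\<forall>x\<in>Rn n. \<forall>y\<in>Rn n. \<forall>t::real. 0 \<le> t \<and> t \<le> 1 \<longrightarrow>
      f (\<lambda>i. (1 - t) * x i + t * y i) \<le> (1 - t) * f x + t * f y)"

definition strict_cvx :: "nat \<Rightarrow> (vect \<Rightarrow> real) \<Rightarrow> bool" where
  "strict_cvx n f \<longleftrightarrow> (\<forall>x\<in>Rn n. \<forall>y\<in>Rn n. \<forall>t::real. x \<noteq> y \<and> 0 < t \<and> t < 1 \<longrightarrow>
      f (\<lambda>i. (1 - t) * x i + t * y i) < (1 - t) * f x + t * f y)"

definition is_grad :: "nat \<Rightarrow> (vect \<Rightarrow> real) \<Rightarrow> vect \<Rightarrow> vect \<Rightarrow> bool" where
  "is_grad n f x g \<longleftrightarrow> g \<in> Rn n \<and>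
     (\<forall>\<epsilon>>0. \<exists>\<delta>>0. \<forall>y\<in>Rn n. vnorm n (vsub y x) < \<delta> \<longrightarrow>
        \<bar>f y - f x - ip n g (vsub y x)\<bar> \<le> \<epsilon> * vnorm n (vsub y x))"

definition differentiable_Rn :: "nat \<Rightarrow> (vect \<Rightarrow> real) \<Rightarrow> bool" where
  "differentiable_Rn n f \<longleftrightarrow> (\<forall>x\<in>Rn n. \<exists>g. is_grad n f x g)"

definition grad :: "nat \<Rightarrow> (vect \<Rightarrow> real) \<Rightarrow> vect \<Rightarrow> vect" where
  "grad n f x = (THE g. is_grad n f x g)"

definition subgrad :: "nat \<Rightarrow> (vect \<Rightarrow> real) \<Rightarrow> vect \<Rightarrow> vect \<Rightarrow> bool" where
  "subgrad n f x g \<longleftrightarrow> g \<in> Rn n \<and> (\<forall>y\<in>Rn n. f y \<ge> f x + ip n g (vsub y x))"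

definition is_minimizer :: "nat \<Rightarrow> (vect \<Rightarrow> real) \<Rightarrow> vect \<Rightarrow> bool" where
  "is_minimizer n f x \<longleftrightarrow> x \<in> Rn n \<and> (\<forall>y\<in>Rn n. f x \<le> f y)"

definition Dh :: "nat \<Rightarrow> (vect \<Rightarrow> real) \<Rightarrow> vect \<Rightarrow> vect \<Rightarrow> real" where
  "Dh n h u x = h u - h x - ip n (grad n h x) (vsub u x)"

definition BL :: "nat \<Rightarrow> real \<Rightarrow> (vect \<Rightarrow> real) \<Rightarrow> (vect \<Rightarrow> real) \<Rightarrow> bool" where
  "BL n L f h \<longleftrightarrow>
     cvx n f \<and> differentiable_Rn n f \<and> (\<exists>x. is_minimizer n f x) \<and>
     strict_cvx n h \<and> differentiable_Rn n h \<and>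
     cvx n (\<lambda>x. L * h x - f x) \<and>
     (\<forall>lam'>0. \<forall>x\<in>Rn n. \<forall>p\<in>Rn n.
        \<exists>!u. is_minimizer n (\<lambda>u. ip n p (vsub u x) + (1 / lam') * Dh n h u x) u)"

primrec nolips :: "nat \<Rightarrow> real \<Rightarrow> (vect \<Rightarrow> real) \<Rightarrow> (vect \<Rightarrow> real) \<Rightarrow> vect \<Rightarrow> nat \<Rightarrow> vect" where
  "nolips n lam f h x0 0 = x0"
| "nolips n lam f h x0 (Suc k) =
     (THE u. is_minimizer n
        (\<lambda>u. ip n (grad n f (nolips n lam f h x0 k)) (vsub u (nolips n lam f h x0 k))
              + (1 / lam) * Dh n h u (nolips n lam f h x0 k)) u)"

definition PEP_val :: "nat \<Rightarrow> real \<Rightarrow> real \<Rightarrow> ereal" where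
  "PEP_val N L lam = Sup {ereal ((f (nolips n lam f h x0 N) - f xs) / Dh n h xs x0) | n f h x0 xs.
       n \<ge> 1 \<and> BL n L f h \<and> x0 \<in> Rn n \<and> is_minimizer n f xs}"

text \<open>Index set I = {0,...,N,*}; the index * is encoded as N+1.\<close>

definition star :: "nat \<Rightarrow> nat" where
  "star N = Suc N"

definition Iset :: "nat \<Rightarrow> nat set" where
  "Iset N = {0..Suc N}"

definition PEPbar_feasible ::
  "nat \<Rightarrow> real \<Rightarrow> real \<Rightarrow> nat \<Rightarrow> (nat \<Rightarrow> vect) \<Rightarrow> (nat \<Rightarrow> real) \<Rightarrow> (nat \<Rightarrow> vect)
     \<Rightarrow> (nat \<Rightarrow> real) \<Rightarrow> (nat \<Rightarrow> vect) \<Rightarrow> bool" where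
  "PEPbar_feasible N L lam n x fv g hv s \<longleftrightarrow>
     (\<forall>i\<in>Iset N. x i \<in> Rn n \<and> g i \<in> Rn n \<and> s i \<in> Rn n) \<and>
     (\<exists>F H. cvx n F \<and> cvx n (\<lambda>y. L * H y - F y) \<and>
        (\<forall>i\<in>Iset N. fv i = F (x i) \<and> subgrad n F (x i) (g i) \<and>
                     hv i = H (x i) \<and> subgrad n H (x i) (s i) \<and>
                     subgrad n (\<lambda>y. L * H y - F y) (x i) (\<lambda>k. L * s i k - g i k))) \<and>
     g (star N) = vzero \<and>
     (\<forall>i<N. s (Suc i) = (\<lambda>k. s i k - lam * g i k)) \<and>
     hv (star N) - hv 0 - ip n (s 0) (vsub (x (star N)) (x 0)) = 1"

definition PEPbar_val :: "nat \<Rightarrow> real \<Rightarrow> real \<Rightarrow> ereal" where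
  "PEPbar_val N L lam = Sup {ereal (fv N - fv (star N)) | n x fv g hv s.
       n \<ge> 1 \<and> PEPbar_feasible N L lam n x fv g hv s}"

text \<open>The (SDP). Rows/columns of G are indexed by pairs (a,i), a \<in> {x,g,s}, i \<in> I.\<close>

datatype blk = BX | BG | BS

definition Jset :: "nat \<Rightarrow> (blk \<times> nat) set" where
  "Jset N = {BX, BG, BS} \<times> Iset N"

definition sym_psd :: "nat \<Rightarrow> ((blk \<times> nat) \<Rightarrow> (blk \<times> nat) \<Rightarrow> real) \<Rightarrow> bool" where
  "sym_psd N G \<longleftrightarrow> (\<forall>p\<in>Jset N. \<forall>q\<in>Jset N. G p q = G q p) \<and>
     (\<forall>v. (\<Sum>p\<in>Jset N. \<Sum>q\<in>Jset N. v p * G p q * v q) \<ge> 0)"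

definition SDP_feasible ::
  "nat \<Rightarrow> real \<Rightarrow> real \<Rightarrow> (nat \<Rightarrow> real) \<Rightarrow> (nat \<Rightarrow> real)
     \<Rightarrow> ((blk \<times> nat) \<Rightarrow> (blk \<times> nat) \<Rightarrow> real) \<Rightarrow> bool" where
  "SDP_feasible N L lam F H G \<longleftrightarrow>
     sym_psd N G \<and>
     (\<forall>i\<in>Iset N. \<forall>j\<in>Iset N.
        F i - F j - G (BG, j) (BX, i) + G (BG, j) (BX, j) \<ge> 0 \<and>
        (L * H i - F i) - (L * H j - F j) - L * (G (BS, j) (BX, i) - G (BS, j) (BX, j))
          + G (BG, j) (BX, i) - G (BG, j) (BX, j) \<ge> 0) \<and>
     G (BG, star N) (BG, star N) = 0 \<and>
     (\<forall>i<N. \<forall>j\<in>Iset N. G (BS, Suc i) (BX, j) = G (BS, i) (BX, j) - lam * G (BG, i) (BX, j)) \<and>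
     H (star N) - H 0 - G (BS, 0) (BX, star N) + G (BS, 0) (BX, 0) = 1"

definition SDP_val :: "nat \<Rightarrow> real \<Rightarrow> real \<Rightarrow> ereal" where
  "SDP_val N L lam = Sup {ereal (F N - F (star N)) | F H G. SDP_feasible N L lam F H G}"

end

theory Submission
  imports Defs
begin

text \<open>The three values are compared cyclically. Gradients along a NoLips run, rescaled by
  \<open>D\<^sub>h(x\<^sub>*, x\<^sub>0)\<close>, give a feasible point of the relaxed problem, and the Gram matrix of such a
  point is feasible for (SDP). Conversely, mixing an (SDP) point with a Slater point makes all
  interpolation inequalities strict at an arbitrarily small cost in the objective. A Gram
  factorization then yields data whose tangent planes are, at each node, strictly dominated by the
  node's own plane. Replacing the maximum of these planes by a smoothed maximum that is exact
  where one plane dominates by a margin gives differentiable convex interpolants \<open>f\<close> and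
  \<open>L h - f\<close>; a small multiple of \<open>\<bar>y\<bar>\<^sup>2\<close> kept in the latter makes \<open>h\<close> strictly convex and the
  Bregman proximal steps well posed, so that the nodes are exactly the NoLips iterates.\<close>

section \<open>Inner products and gradients\<close>

text \<open>A relaxed point may place two nodes at the same spot with different subgradients, and
  then no differentiable function fits the data; hence only the suprema are compared, not individual
  points. Strictness removes this obstacle: the strict inequalities for \<open>(i, j)\<close> and
  \<open>(j, i)\<close> cannot both hold when \<open>x i = x j\<close>. As there are finitely many
  of them, they also leave a uniform margin, which pays for the smoothing width \<open>d\<close> and
  for the quadratic coefficient \<open>m\<close>. The functions interpolated are \<open>f\<close>
  and \<open>L h - f\<close> rather than \<open>h\<close>, because the constraints are the convexity
  inequalities of these two; \<open>h\<close> is \<open>1 / L\<close> times their sum and so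
  inherits convexity and the prescribed gradients. The smoothing has to reproduce values and
  gradients exactly at the nodes, which a log-sum-exp smoothing would not do. The dimension is free
  in the suprema over functions, so no rank condition on the Gram matrix arises.\<close>

lemma Rn_zero [simp]: "vzero \<in> Rn n" and Rn_vsub: "x \<in> Rn n \<Longrightarrow> y \<in> Rn n \<Longrightarrow> vsub x y \<in> Rn n"
  by (auto simp: Rn_def vzero_def vsub_def)

lemma Rn_lincomb: "x \<in> Rn n \<Longrightarrow> y \<in> Rn n \<Longrightarrow> (\<lambda>i. a * x i + b * y i) \<in> Rn n"
  and Rn_add: "x \<in> Rn n \<Longrightarrow> y \<in> Rn n \<Longrightarrow> (\<lambda>i. x i + y i) \<in> Rn n"
  and Rn_diff: "x \<in> Rn n \<Longrightarrow> y \<in> Rn n \<Longrightarrow> (\<lambda>i. x i - y i) \<in> Rn n"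
  and Rn_scale: "x \<in> Rn n \<Longrightarrow> (\<lambda>i. a * x i) \<in> Rn n"
  by (auto simp: Rn_def)

lemma Rn_eqI:
  assumes "x \<in> Rn n" "y \<in> Rn n" "\<And>i. i < n \<Longrightarrow> x i = y i"
  shows "x = y"
proof
  fix i show "x i = y i"
    using assms by (cases "i < n") (auto simp: Rn_def)
qed

lemma ip_commute: "ip n x y = ip n y x"
  by (simp add: ip_def mult.commute)

lemma ip_vsub_right: "ip n g (vsub y x) = ip n g y - ip n g x"
  and ip_vsub_left: "ip n (vsub y x) g = ip n y g - ip n x g"
  and ip_zero_left [simp]: "ip n vzero g = 0"
  and ip_zero_right [simp]: "ip n g vzero = 0"
  and ip_add_left: "ip n (\<lambda>i. x i + y i) g = ip n x g + ip n y g"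
  and ip_diff_left: "ip n (\<lambda>i. x i - y i) g = ip n x g - ip n y g"
  and ip_scale_left: "ip n (\<lambda>i. a * x i) g = a * ip n x g"
  and ip_add_right: "ip n g (\<lambda>i. x i + y i) = ip n g x + ip n g y"
  and ip_diff_right: "ip n g (\<lambda>i. x i - y i) = ip n g x - ip n g y"
  and ip_scale_right: "ip n g (\<lambda>i. a * x i) = a * ip n g x"
  by (simp_all add: ip_def vsub_def vzero_def algebra_simps sum.distrib sum_subtractf
      sum_distrib_left)

lemmas ip_linear = ip_vsub_right ip_vsub_left ip_add_left ip_diff_left ip_scale_left
  ip_add_right ip_diff_right ip_scale_right

lemma ip_self_nonneg [simp]: "0 \<le> ip n x x"
  by (simp add: ip_def sum_nonneg)

lemma ip_self_eq_0: "x \<in> Rn n \<Longrightarrow> ip n x x = 0 \<longleftrightarrow> x = vzero"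
proof
  assume x: "x \<in> Rn n" and "ip n x x = 0"
  then have "\<forall>i\<in>{..<n}. x i * x i = 0"
    unfolding ip_def by (subst (asm) sum_nonneg_eq_0_iff) auto
  then show "x = vzero"
    by (intro Rn_eqI[OF x Rn_zero]) (auto simp: vzero_def)
qed simp

lemma vnorm_nonneg [simp]: "0 \<le> vnorm n x"
  by (simp add: vnorm_def)

lemma vnorm_square: "(vnorm n x)\<^sup>2 = ip n x x"
  by (simp add: vnorm_def)

lemma vnorm_scale: "vnorm n (\<lambda>i. a * x i) = \<bar>a\<bar> * vnorm n x"
  by (simp add: vnorm_def ip_linear real_sqrt_mult flip: mult.assoc)

lemma ip_Cauchy_Schwarz: "\<bar>ip n x y\<bar> \<le> vnorm n x * vnorm n y"
proof -
  have "(ip n x y)\<^sup>2 \<le> ip n x x * ip n y y"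
    using Cauchy_Schwarz_ineq_sum[of x y "{..<n}"] by (simp add: ip_def power2_eq_square)
  then have "sqrt ((ip n x y)\<^sup>2) \<le> sqrt (ip n x x * ip n y y)"
    by (rule real_sqrt_le_mono)
  then show ?thesis
    by (simp add: vnorm_def real_sqrt_mult)
qed

section \<open>Gradients through first-order expansions\<close>

lemma is_gradI:
  assumes "g \<in> Rn n"
    and "\<And>\<epsilon>. \<epsilon> > 0 \<Longrightarrow> \<exists>\<delta>>0. \<forall>y\<in>Rn n. vnorm n (vsub y x) < \<delta> \<longrightarrow>
        \<bar>f y - f x - ip n g (vsub y x)\<bar> \<le> \<epsilon> * vnorm n (vsub y x)"
  shows "is_grad n f x g"
  using assms by (simp add: is_grad_def)

lemma is_gradE:
  assumes "is_grad n f x g" "\<epsilon> > 0"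
  obtains \<delta> where "\<delta> > 0" "\<And>y. y \<in> Rn n \<Longrightarrow> vnorm n (vsub y x) < \<delta> \<Longrightarrow>
        \<bar>f y - f x - ip n g (vsub y x)\<bar> \<le> \<epsilon> * vnorm n (vsub y x)"
  using assms by (auto simp: is_grad_def)

lemma is_grad_Rn: "is_grad n f x g \<Longrightarrow> g \<in> Rn n"
  by (simp add: is_grad_def)

lemma is_grad_affine:
  assumes "g \<in> Rn n"
  shows "is_grad n (\<lambda>y. c + ip n g (vsub y z)) x g"
  using assms by (intro is_gradI) (auto intro!: exI[of _ 1] simp: ip_linear)

lemma is_grad_add:
  assumes f: "is_grad n f x g" and f': "is_grad n f' x g'"
  shows "is_grad n (\<lambda>y. f y + f' y) x (\<lambda>i. g i + g' i)"
proof (rule is_gradI)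
  show "(\<lambda>i. g i + g' i) \<in> Rn n"
    using is_grad_Rn[OF f] is_grad_Rn[OF f'] by (rule Rn_add)
  fix \<epsilon> :: real assume "\<epsilon> > 0"
  then have e: "\<epsilon> / 2 > 0" by simp
  obtain d where d: "d > 0" "\<And>y. y \<in> Rn n \<Longrightarrow> vnorm n (vsub y x) < d \<Longrightarrow>
        \<bar>f y - f x - ip n g (vsub y x)\<bar> \<le> \<epsilon> / 2 * vnorm n (vsub y x)"
    using is_gradE[OF f e] by metis
  obtain d' where d': "d' > 0" "\<And>y. y \<in> Rn n \<Longrightarrow> vnorm n (vsub y x) < d' \<Longrightarrow>
        \<bar>f' y - f' x - ip n g' (vsub y x)\<bar> \<le> \<epsilon> / 2 * vnorm n (vsub y x)"
    using is_gradE[OF f' e] by metis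
  show "\<exists>\<delta>>0. \<forall>y\<in>Rn n. vnorm n (vsub y x) < \<delta> \<longrightarrow>
        \<bar>f y + f' y - (f x + f' x) - ip n (\<lambda>i. g i + g' i) (vsub y x)\<bar> \<le> \<epsilon> * vnorm n (vsub y x)"
  proof (intro exI[of _ "min d d'"] conjI ballI impI)
    fix y assume "y \<in> Rn n" "vnorm n (vsub y x) < min d d'"
    then show "\<bar>f y + f' y - (f x + f' x) - ip n (\<lambda>i. g i + g' i) (vsub y x)\<bar>
        \<le> \<epsilon> * vnorm n (vsub y x)"
      using d(2)[of y] d'(2)[of y] unfolding ip_add_left by (simp add: abs_le_iff, linarith)
  qed (use d d' in auto)
qed

lemma is_grad_scale:
  assumes f: "is_grad n f x g"
  shows "is_grad n (\<lambda>y. c * f y) x (\<lambda>i. c * g i)"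
proof (rule is_gradI)
  show "(\<lambda>i. c * g i) \<in> Rn n"
    using is_grad_Rn[OF f] by (rule Rn_scale)
  fix \<epsilon> :: real assume "\<epsilon> > 0"
  then have "\<epsilon> / (\<bar>c\<bar> + 1) > 0" by simp
  then obtain d where d: "d > 0" "\<And>y. y \<in> Rn n \<Longrightarrow> vnorm n (vsub y x) < d \<Longrightarrow>
        \<bar>f y - f x - ip n g (vsub y x)\<bar> \<le> \<epsilon> / (\<bar>c\<bar> + 1) * vnorm n (vsub y x)"
    using is_gradE[OF f] by metis
  show "\<exists>\<delta>>0. \<forall>y\<in>Rn n. vnorm n (vsub y x) < \<delta> \<longrightarrow>
        \<bar>c * f y - c * f x - ip n (\<lambda>i. c * g i) (vsub y x)\<bar> \<le> \<epsilon> * vnorm n (vsub y x)"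
  proof (intro exI[of _ d] conjI ballI impI)
    fix y assume y: "y \<in> Rn n" "vnorm n (vsub y x) < d"
    have "c * f y - c * f x - ip n (\<lambda>i. c * g i) (vsub y x) = c * (f y - f x - ip n g (vsub y x))"
      by (simp add: ip_scale_left algebra_simps)
    then have "\<bar>c * f y - c * f x - ip n (\<lambda>i. c * g i) (vsub y x)\<bar>
        = \<bar>c\<bar> * \<bar>f y - f x - ip n g (vsub y x)\<bar>"
      by (simp add: abs_mult)
    also have "\<dots> \<le> (\<bar>c\<bar> + 1) * (\<epsilon> / (\<bar>c\<bar> + 1) * vnorm n (vsub y x))"
      using d(2)[OF y] by (intro mult_mono) auto
    also have "\<dots> = \<epsilon> * vnorm n (vsub y x)"
      by simp
    finally show "\<bar>c * f y - c * f x - ip n (\<lambda>i. c * g i) (vsub y x)\<bar> \<le> \<epsilon> * vnorm n (vsub y x)" .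
  qed (use d in auto)
qed

lemma is_grad_diff:
  assumes "is_grad n f x g" "is_grad n f' x g'"
  shows "is_grad n (\<lambda>y. f y - f' y) x (\<lambda>i. g i - g' i)"
  using is_grad_add[OF assms(1) is_grad_scale[OF assms(2), of "-1"]] by simp

lemma is_grad_ip_self:
  assumes "x \<in> Rn n"
  shows "is_grad n (\<lambda>y. ip n y y) x (\<lambda>i. 2 * x i)"
proof (rule is_gradI)
  fix \<epsilon> :: real assume e: "\<epsilon> > 0"
  have "\<bar>ip n y y - ip n x x - ip n (\<lambda>i. 2 * x i) (vsub y x)\<bar> \<le> \<epsilon> * vnorm n (vsub y x)"
    if "vnorm n (vsub y x) < \<epsilon>" for y
  proof -
    have "ip n y y - ip n x x - ip n (\<lambda>i. 2 * x i) (vsub y x) = ip n (vsub y x) (vsub y x)"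
      by (simp add: ip_linear ip_commute[of n y x])
    also have "\<dots> = vnorm n (vsub y x) * vnorm n (vsub y x)"
      by (simp flip: vnorm_square power2_eq_square)
    finally show ?thesis
      using that by (simp add: mult_right_mono)
  qed
  then show "\<exists>\<delta>>0. \<forall>y\<in>Rn n. vnorm n (vsub y x) < \<delta> \<longrightarrow>
      \<bar>ip n y y - ip n x x - ip n (\<lambda>i. 2 * x i) (vsub y x)\<bar> \<le> \<epsilon> * vnorm n (vsub y x)"
    using e by blast
qed (rule Rn_scale[OF assms])

lemma is_grad_locally_Lipschitz:
  assumes "is_grad n f x g"
  obtains C \<delta> where "C \<ge> 0" "\<delta> > 0"
    "\<And>y. y \<in> Rn n \<Longrightarrow> vnorm n (vsub y x) < \<delta> \<Longrightarrow> \<bar>f y - f x\<bar> \<le> C * vnorm n (vsub y x)"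
proof -
  obtain \<delta> where d: "\<delta> > 0" "\<And>y. y \<in> Rn n \<Longrightarrow> vnorm n (vsub y x) < \<delta> \<Longrightarrow>
        \<bar>f y - f x - ip n g (vsub y x)\<bar> \<le> 1 * vnorm n (vsub y x)"
    using is_gradE[OF assms, of 1] by auto
  have "\<bar>f y - f x\<bar> \<le> (1 + vnorm n g) * vnorm n (vsub y x)"
    if "y \<in> Rn n" "vnorm n (vsub y x) < \<delta>" for y
    using d(2)[OF that] ip_Cauchy_Schwarz[of n g "vsub y x"] by (simp add: algebra_simps abs_le_iff)
  then show ?thesis
    using d(1) that[of "1 + vnorm n g" \<delta>] by simp
qed

text \<open>Restriction to a line through \<open>x\<close> reduces gradients to one-variable
  calculus. A suitable direction \<open>d\<close> then gives uniqueness, the first-order condition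
  at minimizers and the subgradient inequality.\<close>

lemma is_grad_DERIV:
  assumes f: "is_grad n f x g" and x: "x \<in> Rn n" and d: "d \<in> Rn n"
  shows "((\<lambda>t. f (\<lambda>i. x i + t * d i)) has_real_derivative ip n g d) (at 0)"
proof -
  have "((\<lambda>t. (f (\<lambda>i. x i + t * d i) - f x) / t) \<longlongrightarrow> ip n g d) (at 0)"
  proof (rule LIM_I)
    fix r :: real assume r: "r > 0"
    define e where "e = r / (2 * (vnorm n d + 1))"
    have n1: "vnorm n d + 1 > 0"
      using vnorm_nonneg[of n d] by linarith
    have e: "e > 0" "e * vnorm n d < r"
      using r n1 by (auto simp: e_def divide_simps)
    obtain \<delta> where \<delta>: "\<delta> > 0" "\<And>y. y \<in> Rn n \<Longrightarrow> vnorm n (vsub y x) < \<delta> \<Longrightarrow>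
        \<bar>f y - f x - ip n g (vsub y x)\<bar> \<le> e * vnorm n (vsub y x)"
      using is_gradE[OF f e(1)] by metis
    show "\<exists>s>0. \<forall>t. t \<noteq> 0 \<and> norm (t - 0) < s \<longrightarrow>
        norm ((f (\<lambda>i. x i + t * d i) - f x) / t - ip n g d) < r"
    proof (intro exI[of _ "\<delta> / (vnorm n d + 1)"] conjI allI impI)
      fix t :: real assume t: "t \<noteq> 0 \<and> norm (t - 0) < \<delta> / (vnorm n d + 1)"
      define y where "y = (\<lambda>i. x i + t * d i)"
      have y: "y \<in> Rn n"
        unfolding y_def by (intro Rn_add Rn_scale x d)
      have yx: "vsub y x = (\<lambda>i. t * d i)"
        by (simp add: y_def vsub_def)
      have "\<bar>t\<bar> * (vnorm n d + 1) < \<delta>"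
        using t n1 by (simp add: pos_less_divide_eq)
      then have "vnorm n (vsub y x) < \<delta>"
        unfolding yx vnorm_scale by (simp add: distrib_left)
      from \<delta>(2)[OF y this] have *: "\<bar>f y - f x - t * ip n g d\<bar> \<le> \<bar>t\<bar> * (e * vnorm n d)"
        unfolding yx vnorm_scale ip_scale_right by (simp add: mult_ac)
      have "(f y - f x) / t - ip n g d = (f y - f x - t * ip n g d) / t"
        using t by (simp add: field_simps)
      then have "\<bar>(f y - f x) / t - ip n g d\<bar> = \<bar>f y - f x - t * ip n g d\<bar> / \<bar>t\<bar>"
        by simp
      also have "\<dots> \<le> e * vnorm n d"
        using * t by (simp add: divide_le_eq mult.commute)
      finally show "norm ((f (\<lambda>i. x i + t * d i) - f x) / t - ip n g d) < r"
        using e(2) by (simp add: y_def)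
    qed (use \<delta> n1 in auto)
  qed
  then show ?thesis
    by (simp add: DERIV_def)
qed

lemma is_grad_unique:
  assumes "is_grad n f x g" "is_grad n f x g'" "x \<in> Rn n"
  shows "g = g'"
proof -
  have R: "g \<in> Rn n" "g' \<in> Rn n"
    using assms is_grad_Rn by auto
  then have d: "vsub g g' \<in> Rn n"
    by (rule Rn_vsub)
  have "ip n g (vsub g g') = ip n g' (vsub g g')"
    by (rule DERIV_unique[OF is_grad_DERIV is_grad_DERIV]) (use assms d in auto)
  then have "ip n (vsub g g') (vsub g g') = 0"
    unfolding ip_vsub_left by simp
  then have "vsub g g' = vzero"
    using ip_self_eq_0[OF d] by simp
  then show ?thesis
    by (auto simp: vsub_def vzero_def fun_eq_iff)
qed

lemma grad_eq: "is_grad n f x g \<Longrightarrow> x \<in> Rn n \<Longrightarrow> grad n f x = g"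
  unfolding grad_def by (rule the_equality) (auto intro: is_grad_unique)

lemma is_grad_grad: "differentiable_Rn n f \<Longrightarrow> x \<in> Rn n \<Longrightarrow> is_grad n f x (grad n f x)"
  unfolding differentiable_Rn_def by (metis grad_eq)

lemma is_minimizer_grad_0:
  assumes g: "is_grad n f x g" and x: "is_minimizer n f x"
  shows "g = vzero"
proof -
  have R: "g \<in> Rn n" "x \<in> Rn n"
    using assms is_grad_Rn by (auto simp: is_minimizer_def)
  \<comment> \<open>The test direction is \<open>g\<close> itself, so the vanishing one-dimensional
    derivative is the squared norm of \<open>g\<close>.\<close>
  have "ip n g g = 0"
  proof (rule DERIV_local_min[OF is_grad_DERIV[OF g R(2,1)], of 1])
    show "\<forall>y. \<bar>0 - y\<bar> < 1 \<longrightarrow> f (\<lambda>i. x i + 0 * g i) \<le> f (\<lambda>i. x i + y * g i)"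
      using x R by (auto simp: is_minimizer_def intro!: Rn_add Rn_scale)
  qed simp
  then show ?thesis
    using R ip_self_eq_0 by auto
qed

section \<open>Convexity, subgradients and strict convexity\<close>

lemma strict_cvx_imp_cvx:
  assumes "strict_cvx n f"
  shows "cvx n f"
  unfolding cvx_def
proof (intro ballI allI impI)
  fix x y and t :: real assume a: "x \<in> Rn n" "y \<in> Rn n" "0 \<le> t \<and> t \<le> 1"
  show "f (\<lambda>i. (1 - t) * x i + t * y i) \<le> (1 - t) * f x + t * f y"
  proof (cases "x \<noteq> y \<and> 0 < t \<and> t < 1")
    case True
    then show ?thesis
      using a assms by (fastforce simp: strict_cvx_def intro: less_imp_le)
  next
    case False
    then consider "x = y" | "t = 0" | "t = 1" using a by linarith
    then show ?thesis
      by cases (simp_all add: algebra_simps)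
  qed
qed

text \<open>By convexity every difference quotient from \<open>x\<close> towards \<open>y\<close> is
  at most \<open>f y - f x\<close>; the bound survives the limit from the right.\<close>

lemma cvx_is_grad_imp_subgrad:
  assumes c: "cvx n f" and g: "is_grad n f x g" and x: "x \<in> Rn n"
  shows "subgrad n f x g"
  unfolding subgrad_def
proof (intro conjI ballI)
  show "g \<in> Rn n" using g by (rule is_grad_Rn)
  fix y assume y: "y \<in> Rn n"
  have "((\<lambda>t. (f (\<lambda>i. x i + t * vsub y x i) - f x) / t) \<longlongrightarrow> ip n g (vsub y x)) (at_right 0)"
    using is_grad_DERIV[OF g x Rn_vsub[OF y x]]
    by (simp add: DERIV_def filterlim_at_split)
  moreover have "eventually (\<lambda>t. (f (\<lambda>i. x i + t * vsub y x i) - f x) / t \<le> f y - f x) (at_right 0)"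
    unfolding eventually_at_right_field
  proof (intro exI[of _ 1] conjI allI impI)
    fix t :: real assume t: "0 < t" "t < 1"
    have "(\<lambda>i. x i + t * vsub y x i) = (\<lambda>i. (1 - t) * x i + t * y i)"
      by (simp add: vsub_def algebra_simps)
    then have "f (\<lambda>i. x i + t * vsub y x i) \<le> (1 - t) * f x + t * f y"
      using c x y t by (simp add: cvx_def)
    then show "(f (\<lambda>i. x i + t * vsub y x i) - f x) / t \<le> f y - f x"
      using t by (simp only: pos_divide_le_eq) (simp add: algebra_simps)
  qed simp
  ultimately have "ip n g (vsub y x) \<le> f y - f x"
    by (rule tendsto_upperbound) simp
  then show "f y \<ge> f x + ip n g (vsub y x)" by simp
qed

lemma cvx_add: "cvx n f \<Longrightarrow> cvx n g \<Longrightarrow> cvx n (\<lambda>y. f y + g y)"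
  unfolding cvx_def
proof (intro ballI allI impI)
  fix x y and t :: real
  assume f: "\<forall>x\<in>Rn n. \<forall>y\<in>Rn n. \<forall>t. 0 \<le> t \<and> t \<le> 1 \<longrightarrow>
      f (\<lambda>i. (1 - t) * x i + t * y i) \<le> (1 - t) * f x + t * f y"
    and g: "\<forall>x\<in>Rn n. \<forall>y\<in>Rn n. \<forall>t. 0 \<le> t \<and> t \<le> 1 \<longrightarrow>
      g (\<lambda>i. (1 - t) * x i + t * y i) \<le> (1 - t) * g x + t * g y"
    and a: "x \<in> Rn n" "y \<in> Rn n" "0 \<le> t \<and> t \<le> 1"
  show "f (\<lambda>i. (1 - t) * x i + t * y i) + g (\<lambda>i. (1 - t) * x i + t * y i)
      \<le> (1 - t) * (f x + g x) + t * (f y + g y)"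
    using f[rule_format, OF a] g[rule_format, OF a] by (simp add: distrib_left)
qed

lemma cvx_scale:
  assumes "cvx n f" "0 \<le> c"
  shows "cvx n (\<lambda>y. c * f y)"
  unfolding cvx_def
proof (intro ballI allI impI)
  fix x y and t :: real assume "x \<in> Rn n" "y \<in> Rn n" "0 \<le> t \<and> t \<le> 1"
  then have "c * f (\<lambda>i. (1 - t) * x i + t * y i) \<le> c * ((1 - t) * f x + t * f y)"
    using assms by (intro mult_left_mono) (auto simp: cvx_def)
  then show "c * f (\<lambda>i. (1 - t) * x i + t * y i) \<le> (1 - t) * (c * f x) + t * (c * f y)"
    by (simp add: algebra_simps)
qed

lemma cvx_affine: "cvx n (\<lambda>y. c + ip n g (vsub y z))"
  unfolding cvx_def ip_linear by (simp add: algebra_simps)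

text \<open>The squared norm has an exact convexity defect: at \<open>z\<close> it lies below the
  chord by \<open>t * (1 - t)\<close> times the squared distance of \<open>x\<close> and
  \<open>y\<close>.\<close>

lemma strict_cvx_cvx_add_square:
  assumes Q: "cvx n Q" and c: "c > 0"
  shows "strict_cvx n (\<lambda>y. Q y + c * ip n y y)"
  unfolding strict_cvx_def
proof (intro ballI allI impI)
  fix x y and t :: real assume a: "x \<in> Rn n" "y \<in> Rn n" "x \<noteq> y \<and> 0 < t \<and> t < 1"
  define z where "z = (\<lambda>i. (1 - t) * x i + t * y i)"
  have "vsub x y \<noteq> vzero"
    using a by (auto simp: vsub_def vzero_def fun_eq_iff)
  then have "ip n (vsub x y) (vsub x y) > 0"
    using ip_self_eq_0[OF Rn_vsub[OF a(1,2)]] ip_self_nonneg[of n "vsub x y"] by linarith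
  then have "c * (t * ((1 - t) * ip n (vsub x y) (vsub x y))) > 0"
    using a c by simp
  moreover have "ip n z z = (1 - t) * ip n x x + t * ip n y y
      - t * ((1 - t) * ip n (vsub x y) (vsub x y))"
    unfolding z_def by (simp add: ip_linear ip_commute[of n y x] algebra_simps)
  ultimately have "c * ip n z z < c * ((1 - t) * ip n x x + t * ip n y y)"
    by (simp only: right_diff_distrib)
  moreover have "Q z \<le> (1 - t) * Q x + t * Q y"
    using Q a by (simp add: cvx_def z_def)
  ultimately show "Q z + c * ip n z z < (1 - t) * (Q x + c * ip n x x) + t * (Q y + c * ip n y y)"
    by (simp add: algebra_simps)
qed

section \<open>Existence of Bregman proximal points\<close>

lemma continuous_on_vnorm_vsub: "continuous_on S (\<lambda>y. vnorm n (vsub y x))"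
  unfolding vnorm_def ip_def vsub_def
  by (intro continuous_intros continuous_on_subset[OF continuous_on_product_coordinates]) auto

text \<open>The type \<open>vect\<close> carries the product topology, while \<open>is_grad\<close>
  measures increments by \<open>vnorm\<close>. Since \<open>vnorm\<close> depends continuously on
  finitely many coordinates, the first-order bound transfers to product neighbourhoods.\<close>

lemma differentiable_imp_continuous_on:
  assumes "differentiable_Rn n f"
  shows "continuous_on (Rn n) f"
  unfolding continuous_on_def
proof
  fix x assume x: "x \<in> Rn n"
  obtain C \<delta> where C: "C \<ge> 0" "\<delta> > 0"
    "\<And>y. y \<in> Rn n \<Longrightarrow> vnorm n (vsub y x) < \<delta> \<Longrightarrow> \<bar>f y - f x\<bar> \<le> C * vnorm n (vsub y x)"
    using is_grad_locally_Lipschitz[OF is_grad_grad[OF assms x]] by metis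
  have "((\<lambda>y. vnorm n (vsub y x)) \<longlongrightarrow> vnorm n (vsub x x)) (at x within Rn n)"
    using continuous_on_vnorm_vsub[of "Rn n" n x] x unfolding continuous_on_def by blast
  moreover have "vnorm n (vsub x x) = 0"
    by (simp add: vnorm_def vsub_def ip_def)
  ultimately have lim: "((\<lambda>y. vnorm n (vsub y x)) \<longlongrightarrow> 0) (at x within Rn n)"
    by simp
  have "((\<lambda>y. f y - f x) \<longlongrightarrow> 0) (at x within Rn n)"
  proof (rule Lim_null_comparison)
    show "((\<lambda>y. C * vnorm n (vsub y x)) \<longlongrightarrow> 0) (at x within Rn n)"
      using tendsto_mult_right_zero[OF lim] .
    have "\<forall>\<^sub>F y in at x within Rn n. vnorm n (vsub y x) < \<delta>"
      using order_tendstoD(2)[OF lim C(2)] .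
    then show "\<forall>\<^sub>F y in at x within Rn n. norm (f y - f x) \<le> C * vnorm n (vsub y x)"
      unfolding eventually_at_topological using C(3) by auto
  qed
  then show "(f \<longlongrightarrow> f x) (at x within Rn n)"
    using Lim_null by blast
qed

text \<open>Tychonoff: the box is a product of compact sets, intervals below \<open>n\<close> and
  subsets of \<open>{0}\<close> from \<open>n\<close> on.\<close>

lemma compact_Rn_box:
  fixes R :: real
  shows "compact {u \<in> Rn n. \<forall>i. \<bar>u i\<bar> \<le> R}"
proof -
  \<comment> \<open>Intersecting \<open>{0}\<close> with \<open>{-R..R}\<close> keeps the
    coordinatewise description correct for negative \<open>R\<close>, where the box is
    empty.\<close>
  define B :: "nat \<Rightarrow> real set" where "B = (\<lambda>i. if i < n then {-R..R} else {0} \<inter> {-R..R})"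
  have "compactin (product_topology (\<lambda>i. euclidean) UNIV) (PiE UNIV B)"
    unfolding compactin_PiE by (auto simp: B_def compact_Int)
  then have "compact (PiE UNIV B)"
    by (simp add: euclidean_product_topology)
  also have "PiE UNIV B = {u \<in> Rn n. \<forall>i. \<bar>u i\<bar> \<le> R}"
  proof -
    have "u i \<in> B i \<longleftrightarrow> \<bar>u i\<bar> \<le> R \<and> (n \<le> i \<longrightarrow> u i = 0)" for u :: vect and i
      by (auto simp: B_def)
    then show ?thesis
      by (auto simp: Rn_def PiE_UNIV_domain)
  qed
  finally show ?thesis .
qed

lemma abs_le_vnorm:
  assumes "u \<in> Rn n"
  shows "\<bar>u i\<bar> \<le> vnorm n u"
proof (cases "i < n")
  case True
  then have "u i * u i \<le> ip n u u"
    unfolding ip_def by (intro member_le_sum) auto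
  then have "sqrt ((u i)\<^sup>2) \<le> vnorm n u"
    unfolding vnorm_def power2_eq_square by (rule real_sqrt_le_mono)
  then show ?thesis by simp
next
  case False
  then show ?thesis using assms by (simp add: Rn_def)
qed

lemma strict_cvx_coercive_ex1_minimizer:
  assumes diff: "differentiable_Rn n \<Phi>" and sc: "strict_cvx n \<Phi>"
    and lb: "\<And>u. u \<in> Rn n \<Longrightarrow> \<Phi> u \<ge> \<alpha> + ip n b u + c * ip n u u" and c: "c > 0"
  shows "\<exists>!u. is_minimizer n \<Phi> u"
proof -
  \<comment> \<open>For \<open>r = vnorm n y > R\<close> these constants give
    \<open>c * r > K\<close> and \<open>r \<ge> 1\<close>, hence
    \<open>c * r * r \<ge> M + vnorm n b * r\<close>. The lower bound is then at least
    \<open>\<Phi> vzero\<close>, so minimizing over the box of radius \<open>R\<close> is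
    enough.\<close>
  define M where "M = \<bar>\<Phi> vzero - \<alpha>\<bar>"
  define K where "K = M + vnorm n b"
  define R where "R = 1 + K / c"
  have K: "K \<ge> 0"
    unfolding K_def M_def by simp
  then have R: "R \<ge> 1"
    unfolding R_def using c by simp
  let ?S = "{u \<in> Rn n. \<forall>i. \<bar>u i\<bar> \<le> R}"
  have z: "vzero \<in> ?S"
    using R by (auto simp: vzero_def Rn_def)
  have "continuous_on ?S \<Phi>"
    using differentiable_imp_continuous_on[OF diff] by (rule continuous_on_subset) auto
  then obtain u where u: "u \<in> ?S" "\<And>y. y \<in> ?S \<Longrightarrow> \<Phi> u \<le> \<Phi> y"
    using continuous_attains_inf[OF compact_Rn_box, of n R \<Phi>] z by blast
  have "\<Phi> u \<le> \<Phi> y" if y: "y \<in> Rn n" for y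
  proof (cases "vnorm n y \<le> R")
    case True
    then have "y \<in> ?S"
      using y abs_le_vnorm[OF y] by (auto intro: order_trans)
    then show ?thesis by (rule u(2))
  next
    case False
    then have r: "vnorm n y > R" "vnorm n y \<ge> 1" using R by auto
    have "c * vnorm n y > c * R"
      using r c by simp
    then have "c * vnorm n y > K"
      using c by (simp add: R_def distrib_left)
    then have "vnorm n y * (c * vnorm n y) \<ge> vnorm n y * K"
      by (intro mult_left_mono) auto
    moreover have "M * 1 \<le> M * vnorm n y"
      using r by (intro mult_left_mono) (auto simp: M_def)
    moreover have "\<Phi> vzero - \<alpha> \<le> M"
      by (simp add: M_def)
    moreover have "ip n b y \<ge> - (vnorm n b * vnorm n y)"
      using ip_Cauchy_Schwarz[of n b y] by linarith
    moreover have "c * ip n y y = vnorm n y * (c * vnorm n y)"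
      unfolding vnorm_square[symmetric] power2_eq_square by simp
    moreover have "vnorm n y * K = M * vnorm n y + vnorm n b * vnorm n y"
      by (simp add: K_def algebra_simps)
    ultimately have "\<alpha> + ip n b y + c * ip n y y \<ge> \<Phi> vzero"
      by linarith
    then show ?thesis
      using lb[OF y] u(2)[OF z] by linarith
  qed
  then have min: "is_minimizer n \<Phi> u"
    using u(1) by (auto simp: is_minimizer_def)
  moreover have "v = u" if v: "is_minimizer n \<Phi> v" for v
  proof (rule ccontr)
    assume "v \<noteq> u"
    define w where "w = (\<lambda>i. (1 - 1/2) * v i + 1/2 * u i)"
    have R: "v \<in> Rn n" "u \<in> Rn n" and eq: "\<Phi> v = \<Phi> u"
      using min v by (auto simp: is_minimizer_def intro: antisym)
    have w: "w \<in> Rn n"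
      unfolding w_def by (rule Rn_lincomb[OF R])
    have "\<Phi> w < (1 - 1/2) * \<Phi> v + 1/2 * \<Phi> u"
      using sc[unfolded strict_cvx_def, rule_format, OF R, of "1/2"] \<open>v \<noteq> u\<close> by (simp add: w_def)
    moreover have "\<Phi> u \<le> \<Phi> w"
      using min w by (auto simp: is_minimizer_def)
    ultimately show False using eq by simp
  qed
  ultimately show ?thesis by blast
qed

text \<open>The quadratic part of \<open>h\<close> enters the proximal objective with coefficient
  \<open>c / lam\<close>. The remainder \<open>Q1\<close> is convex and differentiable, so its
  tangent plane at the origin supplies the affine part of the coercive bound.\<close>

lemma Bregman_prox_ex1:
  fixes Q :: "vect \<Rightarrow> real"
  assumes Q: "cvx n Q" "differentiable_Rn n Q" and c: "c > 0" and lam: "lam > 0"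
    and h: "h = (\<lambda>y. Q y + c * ip n y y)"
    and x: "x \<in> Rn n" and p: "p \<in> Rn n"
  shows "\<exists>!u. is_minimizer n (\<lambda>u. ip n p (vsub u x) + (1 / lam) * Dh n h u x) u"
proof -
  define gh where "gh = grad n h x"
  define a where "a = (\<lambda>i. p i - 1 / lam * gh i)"
  define Q1 where "Q1 = (\<lambda>u. (- (1 / lam) * h x + ip n a (vsub u x)) + 1 / lam * Q u)"
  have hx: "is_grad n h y (\<lambda>i. grad n Q y i + c * (2 * y i))" if "y \<in> Rn n" for y
    unfolding h using that by (intro is_grad_add is_grad_grad Q is_grad_scale is_grad_ip_self)
  have "gh \<in> Rn n"
    unfolding gh_def grad_eq[OF hx[OF x] x] by (rule is_grad_Rn[OF hx[OF x]])
  then have a: "a \<in> Rn n"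
    unfolding a_def by (intro Rn_diff Rn_scale p)
  have eq: "(\<lambda>u. ip n p (vsub u x) + (1 / lam) * Dh n h u x) = (\<lambda>u. Q1 u + c / lam * ip n u u)"
    unfolding Q1_def a_def ip_diff_left ip_scale_left Dh_def gh_def[symmetric]
    by (simp add: h algebra_simps add_divide_distrib diff_divide_distrib)
  have Q1: "cvx n Q1"
    unfolding Q1_def using lam by (intro cvx_add cvx_affine cvx_scale Q) auto
  have Q1g: "\<exists>g. is_grad n Q1 y g" if "y \<in> Rn n" for y
    unfolding Q1_def using is_grad_add[OF is_grad_affine[OF a] is_grad_scale[OF is_grad_grad[OF Q(2) that]]]
    by blast
  then have Q1d: "differentiable_Rn n Q1"
    by (simp add: differentiable_Rn_def)
  show ?thesis
    unfolding eq
  proof (rule strict_cvx_coercive_ex1_minimizer)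
    show "strict_cvx n (\<lambda>u. Q1 u + c / lam * ip n u u)"
      using Q1 c lam by (intro strict_cvx_cvx_add_square) auto
    show "differentiable_Rn n (\<lambda>u. Q1 u + c / lam * ip n u u)"
      unfolding differentiable_Rn_def
      using is_grad_add[OF is_grad_grad[OF Q1d] is_grad_scale[OF is_grad_ip_self]] by blast
    fix u assume u: "u \<in> Rn n"
    have "subgrad n Q1 vzero (grad n Q1 vzero)"
      by (intro cvx_is_grad_imp_subgrad Q1 is_grad_grad Q1d Rn_zero)
    then have "Q1 u \<ge> Q1 vzero + ip n (grad n Q1 vzero) (vsub u vzero)"
      using u by (auto simp: subgrad_def)
    then show "Q1 u + c / lam * ip n u u \<ge> Q1 vzero + ip n (grad n Q1 vzero) u + c / lam * ip n u u"
      by (simp add: ip_linear)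
  qed (use c lam in auto)
qed

section \<open>Smooth convex interpolation\<close>

text \<open>\<open>smax d a b\<close> is the maximum over \<open>\<theta> \<in> [0, 1]\<close> of
  \<open>\<theta> a + (1 - \<theta>) b + d \<theta> (1 - \<theta>)\<close>, and \<open>clip d (a - b)\<close> is the maximizer. It is a
  continuously differentiable convex majorant of the maximum which coincides with it
  when \<open>\<bar>a - b\<bar> \<ge> d\<close>.\<close>

definition clip :: "real \<Rightarrow> real \<Rightarrow> real" where
  "clip d t = max 0 (min 1 ((t + d) / (2 * d)))"

definition smax :: "real \<Rightarrow> real \<Rightarrow> real \<Rightarrow> real" where
  "smax d a b = b + (clip d (a - b) * (a - b) + d * (clip d (a - b) * (1 - clip d (a - b))))"

lemma clip_ge_0: "0 \<le> clip d t" and clip_le_1: "clip d t \<le> 1"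
  by (auto simp: clip_def)

text \<open>Completing the square: with \<open>u\<close> the unclipped maximizer, the expression in
  \<open>\<theta>\<close> is \<open>d * (u^2 - (\<theta> - u)^2)\<close>, and \<open>clip\<close>
  picks the point of [0, 1] nearest to \<open>u\<close>.\<close>

lemma smax_ge:
  assumes d: "d > 0" and th: "0 \<le> \<theta>" "\<theta> \<le> 1"
  shows "b + (\<theta> * (a - b) + d * (\<theta> * (1 - \<theta>))) \<le> smax d a b"
proof -
  define t where "t = a - b"
  define u where "u = (t + d) / (2 * d)"
  define c where "c = clip d t"
  have t: "t = d * (2 * u - 1)"
    using d by (simp add: u_def field_simps)
  have c: "c = max 0 (min 1 u)"
    by (simp add: c_def clip_def u_def)
  have "\<bar>c - u\<bar> \<le> \<bar>\<theta> - u\<bar>"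
    unfolding c using th by (auto simp: max_def min_def)
  then have "(c - u)\<^sup>2 \<le> (\<theta> - u)\<^sup>2"
    by (simp only: abs_le_square_iff)
  then have "d * (2 * u * \<theta> - \<theta> * \<theta>) \<le> d * (2 * u * c - c * c)"
    using d by (intro mult_left_mono) (auto simp: power2_eq_square algebra_simps)
  then have "\<theta> * t + d * (\<theta> * (1 - \<theta>)) \<le> c * t + d * (c * (1 - c))"
    unfolding t by (simp add: algebra_simps)
  then show ?thesis
    by (simp add: smax_def t_def c_def)
qed

text \<open>For a fixed weight the maximized expression is affine in \<open>(a, b)\<close>; the
  weight optimal at \<open>(a, b)\<close> yields an affine minorant touching there. Convexity and
  differentiability of \<open>smax\<close> both rest on it.\<close>

lemma smax_supporting_line:
  assumes "d > 0"
  shows "smax d a b + (b' - b) + clip d (a - b) * ((a' - b') - (a - b)) \<le> smax d a' b'"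
  using smax_ge[OF assms clip_ge_0 clip_le_1, of b' d "a - b" a']
  by (simp add: smax_def algebra_simps)

lemma clip_Lipschitz:
  assumes "d > 0"
  shows "(clip d s - clip d t) * (s - t) \<le> (s - t)\<^sup>2 / (2 * d)"
proof -
  have "\<bar>clip d s - clip d t\<bar> \<le> \<bar>(s + d) / (2 * d) - (t + d) / (2 * d)\<bar>"
    unfolding clip_def by (auto simp: max_def min_def)
  also have "\<dots> = \<bar>s - t\<bar> / (2 * d)"
    using assms by (simp flip: diff_divide_distrib)
  finally have "\<bar>clip d s - clip d t\<bar> * \<bar>s - t\<bar> \<le> \<bar>s - t\<bar> / (2 * d) * \<bar>s - t\<bar>"
    by (rule mult_right_mono) simp
  moreover have "\<bar>s - t\<bar> / (2 * d) * \<bar>s - t\<bar> = (s - t)\<^sup>2 / (2 * d)"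
    by (simp add: power2_eq_square)
  ultimately have "\<bar>(clip d s - clip d t) * (s - t)\<bar> \<le> (s - t)\<^sup>2 / (2 * d)"
    by (simp only: abs_mult)
  then show ?thesis by linarith
qed

text \<open>The supporting line at \<open>(a, b)\<close> bounds the remainder below, the one at
  \<open>(a', b')\<close> bounds it above. Their slopes are close because \<open>clip\<close> is
  Lipschitz, so the remainder is quadratic.\<close>

lemma smax_first_order:
  assumes d: "d > 0"
  shows "\<bar>smax d a' b' - smax d a b - (b' - b) - clip d (a - b) * ((a' - b') - (a - b))\<bar>
    \<le> ((a' - b') - (a - b))\<^sup>2 / (2 * d)"
proof -
  define s t where "s = a' - b'" and "t = a - b"
  have 1: "smax d a b + (b' - b) + clip d t * (s - t) \<le> smax d a' b'"
    using smax_supporting_line[OF d] by (simp add: s_def t_def)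
  have "smax d a' b' + (b - b') + clip d s * (t - s) \<le> smax d a b"
    using smax_supporting_line[OF d] by (simp add: s_def t_def)
  then have "smax d a' b' - smax d a b - (b' - b) - clip d t * (s - t) \<le> (clip d s - clip d t) * (s - t)"
    by (simp add: algebra_simps)
  also have "\<dots> \<le> (s - t)\<^sup>2 / (2 * d)"
    by (rule clip_Lipschitz[OF d])
  finally show ?thesis
    using 1 unfolding s_def t_def by (simp add: abs_le_iff)
qed

lemma smax_le:
  assumes "d > 0" "a \<le> c" "b \<le> c"
  shows "smax d a b \<le> c + d"
proof -
  let ?k = "clip d (a - b)"
  have k: "0 \<le> ?k" "?k \<le> 1"
    by (rule clip_ge_0 clip_le_1)+
  have "?k * a + (1 - ?k) * b \<le> ?k * c + (1 - ?k) * c"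
    using k assms by (intro add_mono mult_left_mono) auto
  moreover have "d * (?k * (1 - ?k)) \<le> d * 1"
    using k assms by (intro mult_left_mono mult_le_one) auto
  ultimately show ?thesis
    by (simp add: smax_def algebra_simps)
qed

lemma clip_eq_1: "d > 0 \<Longrightarrow> t \<ge> d \<Longrightarrow> clip d t = 1"
  and clip_eq_0: "d > 0 \<Longrightarrow> t \<le> - d \<Longrightarrow> clip d t = 0"
  by (auto simp: clip_def min_def max_def field_simps)

text \<open>The supporting line at \<open>z\<close> puts nonnegative weights \<open>k\<close> on
  \<open>A\<close> and \<open>1 - k\<close> on \<open>B\<close>; composed with them it is a convex
  minorant that is exact at \<open>z\<close>.\<close>

lemma cvx_smax:
  assumes d: "d > 0" and A: "cvx n A" and B: "cvx n B"
  shows "cvx n (\<lambda>y. smax d (A y) (B y))"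
  unfolding cvx_def
proof (intro ballI allI impI)
  fix x y and t :: real assume a: "x \<in> Rn n" "y \<in> Rn n" "0 \<le> t \<and> t \<le> 1"
  define z where "z = (\<lambda>i. (1 - t) * x i + t * y i)"
  define k where "k = clip d (A z - B z)"
  have k: "0 \<le> k" "k \<le> 1"
    unfolding k_def by (rule clip_ge_0 clip_le_1)+
  have Az: "k * A z \<le> k * ((1 - t) * A x + t * A y)"
    using A a k by (intro mult_left_mono) (auto simp: cvx_def z_def)
  have Bz: "(1 - k) * B z \<le> (1 - k) * ((1 - t) * B x + t * B y)"
    using B a k by (intro mult_left_mono) (auto simp: cvx_def z_def)
  let ?l = "\<lambda>y. smax d (A z) (B z) + (B y - B z) + k * ((A y - B y) - (A z - B z))"
  have "(1 - t) * ?l x + t * ?l y \<le> (1 - t) * smax d (A x) (B x) + t * smax d (A y) (B y)"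
    unfolding k_def using a smax_supporting_line[OF d]
    by (intro add_mono mult_left_mono) auto
  moreover have "smax d (A z) (B z) \<le> (1 - t) * ?l x + t * ?l y"
    using Az Bz by (simp add: algebra_simps)
  ultimately show "smax d (A z) (B z) \<le> (1 - t) * smax d (A x) (B x) + t * smax d (A y) (B y)"
    by linarith
qed

lemma is_grad_smax:
  assumes d: "d > 0" and A: "is_grad n A x gA" and B: "is_grad n B x gB"
  shows "is_grad n (\<lambda>y. smax d (A y) (B y)) x (\<lambda>i. gB i + clip d (A x - B x) * (gA i - gB i))"
proof -
  define k where "k = clip d (A x - B x)"
  define T where "T = (\<lambda>y. A y - B y)"
  \<comment> \<open>\<open>E\<close> is what remains of \<open>smax\<close> after freezing the
    weight at \<open>x\<close>. Its increments from \<open>x\<close> are quadratic in those of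
    \<open>T\<close>, which are at most linear in the distance, so its gradient there
    vanishes.\<close>
  define E where "E = (\<lambda>y. smax d (A y) (B y) - (B y + k * T y))"
  have T: "is_grad n T x (\<lambda>i. gA i - gB i)"
    unfolding T_def by (rule is_grad_diff[OF A B])
  obtain C \<delta> where C: "C \<ge> 0" "\<delta> > 0"
    "\<And>y. y \<in> Rn n \<Longrightarrow> vnorm n (vsub y x) < \<delta> \<Longrightarrow> \<bar>T y - T x\<bar> \<le> C * vnorm n (vsub y x)"
    using is_grad_locally_Lipschitz[OF T] by metis
  have E: "is_grad n E x vzero"
  proof (rule is_gradI)
    fix \<epsilon> :: real assume e: "\<epsilon> > 0"
    \<comment> \<open>This makes \<open>(C\<^sup>2 + 1) * r / (2 * d)\<close> equal to
      \<open>\<epsilon>\<close>; the \<open>+ 1\<close> keeps the divisor positive when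
      \<open>C = 0\<close>.\<close>
    define r where "r = \<epsilon> * (2 * d) / (C\<^sup>2 + 1)"
    have r: "r > 0"
      unfolding r_def using e d by (intro divide_pos_pos) (auto intro: add_nonneg_pos)
    show "\<exists>\<delta>>0. \<forall>y\<in>Rn n. vnorm n (vsub y x) < \<delta> \<longrightarrow>
        \<bar>E y - E x - ip n vzero (vsub y x)\<bar> \<le> \<epsilon> * vnorm n (vsub y x)"
    proof (intro exI[of _ "min \<delta> r"] conjI ballI impI)
      fix y assume y: "y \<in> Rn n" "vnorm n (vsub y x) < min \<delta> r"
      let ?v = "vnorm n (vsub y x)"
      have "\<bar>E y - E x - ip n vzero (vsub y x)\<bar>
          = \<bar>smax d (A y) (B y) - smax d (A x) (B x) - (B y - B x) - k * (T y - T x)\<bar>"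
        by (simp add: E_def algebra_simps)
      also have "\<dots> \<le> (T y - T x)\<^sup>2 / (2 * d)"
        using smax_first_order[OF d] by (simp add: T_def k_def)
      also have "\<dots> \<le> (C * ?v)\<^sup>2 / (2 * d)"
        using power_mono[OF C(3)[OF y(1)], of 2] y d by (simp add: divide_right_mono)
      also have "\<dots> \<le> (C\<^sup>2 + 1) * ?v / (2 * d) * ?v"
        using d by (simp add: power2_eq_square divide_right_mono algebra_simps)
      also have "\<dots> \<le> (C\<^sup>2 + 1) * r / (2 * d) * ?v"
        using y d by (intro mult_right_mono divide_right_mono mult_left_mono) auto
      also have "\<dots> = \<epsilon> * ?v"
      proof -
        have "C\<^sup>2 + 1 \<noteq> 0"
          using zero_le_power2[of C] by linarith
        then show ?thesis using d by (simp add: r_def)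
      qed
      finally show "\<bar>E y - E x - ip n vzero (vsub y x)\<bar> \<le> \<epsilon> * ?v" .
    qed (use r C in auto)
  qed simp
  have "is_grad n (\<lambda>y. (B y + k * T y) + E y) x (\<lambda>i. (gB i + k * (gA i - gB i)) + vzero i)"
    by (intro is_grad_add B is_grad_scale T E)
  then show ?thesis
    by (simp add: E_def k_def vzero_def)
qed

section \<open>Iterated smoothed maximum of finitely many functions\<close>

primrec smooth_max :: "real \<Rightarrow> (nat \<Rightarrow> vect \<Rightarrow> real) \<Rightarrow> nat \<Rightarrow> vect \<Rightarrow> real" where
  "smooth_max d a 0 = a 0"
| "smooth_max d a (Suc k) = (\<lambda>y. smax d (a (Suc k) y) (smooth_max d a k y))"

lemma cvx_smooth_max: "d > 0 \<Longrightarrow> (\<And>i. i \<le> k \<Longrightarrow> cvx n (a i)) \<Longrightarrow> cvx n (smooth_max d a k)"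
  by (induction k) (auto intro: cvx_smax)

lemma smooth_max_has_grad:
  "d > 0 \<Longrightarrow> (\<And>i. i \<le> k \<Longrightarrow> \<exists>g. is_grad n (a i) x g) \<Longrightarrow> \<exists>g. is_grad n (smooth_max d a k) x g"
proof (induction k)
  case (Suc k)
  then obtain g g' where "is_grad n (a (Suc k)) x g" "is_grad n (smooth_max d a k) x g'"
    by (metis le_SucI le_refl)
  then show ?case
    using is_grad_smax[OF Suc.prems(1)] by fastforce
qed auto

lemma smooth_max_le:
  "d > 0 \<Longrightarrow> (\<And>i. i \<le> k \<Longrightarrow> a i y \<le> c) \<Longrightarrow> smooth_max d a k y \<le> c + real k * d"
proof (induction k)
  case (Suc k)
  have "smax d (a (Suc k) y) (smooth_max d a k y) \<le> (c + real k * d) + d"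
  proof (rule smax_le)
    have "a (Suc k) y \<le> c" using Suc.prems by simp
    then show "a (Suc k) y \<le> c + real k * d"
      using Suc.prems(1) by (smt (verit) mult_nonneg_nonneg of_nat_0_le_iff)
  qed (use Suc in auto)
  then show ?case by (simp add: algebra_simps)
qed simp

text \<open>If the dominant index is the last one, the inner layers exceed their largest member by
  at most \<open>d\<close> each, so the margin still leaves \<open>d\<close> at the outer comparison
  and \<open>clip\<close> is 1 there. If it comes earlier, the inner value is already exact by
  induction and the outer \<open>clip\<close> is 0.\<close>

lemma smooth_max_dominant:
  assumes d: "d > 0" and jk: "j \<le> k"
    and gap: "\<And>i. i \<le> k \<Longrightarrow> i \<noteq> j \<Longrightarrow> a i x + real (Suc k) * d \<le> a j x"
    and g: "\<And>i. i \<le> k \<Longrightarrow> is_grad n (a i) x (g i)"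
  shows "smooth_max d a k x = a j x \<and> is_grad n (smooth_max d a k) x (g j)"
  using jk gap g
proof (induction k)
  case 0
  then show ?case by simp
next
  case (Suc k)
  have mono: "real (Suc k) * d \<le> real (Suc (Suc k)) * d"
    using d by (intro mult_right_mono) auto
  have kd: "real (Suc k) * d \<ge> d"
    using d by simp
  obtain g' where g': "is_grad n (smooth_max d a k) x g'"
    using smooth_max_has_grad[OF d, of k n a x] Suc.prems(3) by (metis le_SucI)
  note G = is_grad_smax[OF d Suc.prems(3)[OF le_refl]]
  show ?case
  proof (cases "j = Suc k")
    case True
    have "smooth_max d a k x \<le> (a j x - real (Suc (Suc k)) * d) + real k * d"
    proof (rule smooth_max_le[OF d])
      fix i assume "i \<le> k"
      then show "a i x \<le> a j x - real (Suc (Suc k)) * d"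
        using Suc.prems(2)[of i] True by simp
    qed
    then have "a (Suc k) x - smooth_max d a k x \<ge> d"
      using True d by (simp add: algebra_simps)
    then have c: "clip d (a (Suc k) x - smooth_max d a k x) = 1"
      by (rule clip_eq_1[OF d])
    show ?thesis
      using G[OF g'] unfolding c by (simp add: smax_def c True)
  next
    case False
    have "a i x + real (Suc k) * d \<le> a j x" if "i \<le> k" "i \<noteq> j" for i
      using Suc.prems(2)[of i] that mono by linarith
    then have sx: "smooth_max d a k x = a j x" and gr: "is_grad n (smooth_max d a k) x (g j)"
      using Suc.IH Suc.prems(1,3) False by auto
    moreover have "a (Suc k) x + real (Suc (Suc k)) * d \<le> a j x"
      using Suc.prems(2)[of "Suc k"] False by simp
    ultimately have "a (Suc k) x - smooth_max d a k x \<le> - d"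
      using mono kd by linarith
    then have c: "clip d (a (Suc k) x - smooth_max d a k x) = 0"
      by (rule clip_eq_0[OF d])
    show ?thesis
      using G[OF gr] unfolding c by (simp add: smax_def c[unfolded sx] sx)
  qed
qed

text \<open>Supplies the smoothing width and the quadratic coefficient of the two interpolation
  lemmas. Shrinking \<open>m\<close> for a new index keeps the inequalities already secured: for
  \<open>c p \<ge> 0\<close> by monotonicity, for \<open>c p < 0\<close> because the left side is
  negative.\<close>

lemma finite_uniform_scale:
  fixes w c :: "'a \<Rightarrow> real"
  assumes "finite S" "\<And>p. p \<in> S \<Longrightarrow> w p > 0"
  shows "\<exists>m>0. \<forall>p\<in>S. m * c p < w p"
  using assms
proof (induction S rule: finite_induct)
  case empty
  then show ?case by (auto intro: exI[of _ 1])
next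
  case (insert q S)
  then obtain m where m: "m > 0" "\<forall>p\<in>S. m * c p < w p" by auto
  define m' where "m' = min m (w q / (\<bar>c q\<bar> + 1))"
  have wq: "w q > 0" using insert by simp
  have m': "m' > 0" "m' \<le> m"
    using m wq by (auto simp: m'_def)
  have "m' * c p < w p" if "p \<in> S" for p
  proof (cases "c p \<ge> 0")
    case True
    then have "m' * c p \<le> m * c p" using m' by (intro mult_right_mono) auto
    then show ?thesis using m(2) that by force
  next
    case False
    then have "m' * c p < 0" using m' by (simp add: mult_pos_neg)
    then show ?thesis using insert.prems[of p] that by simp
  qed
  moreover have "m' * c q < w q"
  proof -
    have "m' * c q \<le> m' * \<bar>c q\<bar>" using m' by (intro mult_left_mono) auto
    also have "\<dots> < m' * (\<bar>c q\<bar> + 1)" using m' by simp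
    also have "\<dots> \<le> w q / (\<bar>c q\<bar> + 1) * (\<bar>c q\<bar> + 1)"
      by (intro mult_right_mono) (auto simp: m'_def)
    finally show ?thesis by simp
  qed
  ultimately show ?case using m'(1) by auto
qed

lemma smooth_convex_interpolation:
  fixes K :: nat
  assumes R: "\<And>i. i \<le> K \<Longrightarrow> g i \<in> Rn n"
    and gap: "\<And>i j. i \<le> K \<Longrightarrow> j \<le> K \<Longrightarrow> i \<noteq> j \<Longrightarrow> fv i > fv j + ip n (g j) (vsub (x i) (x j))"
  shows "\<exists>f. cvx n f \<and> differentiable_Rn n f \<and> (\<forall>i\<le>K. f (x i) = fv i \<and> is_grad n f (x i) (g i))"
proof -
  define a where "a = (\<lambda>j y. fv j + ip n (g j) (vsub y (x j)))"
  let ?S = "{(i, j). i \<le> K \<and> j \<le> K \<and> i \<noteq> j}"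
  have "?S \<subseteq> {..K} \<times> {..K}" by auto
  then have "finite ?S" by (rule finite_subset) auto
  moreover have "\<And>p. p \<in> ?S \<Longrightarrow> (case p of (i, j) \<Rightarrow> fv i - a j (x i)) > 0"
    using gap by (auto simp: a_def)
  \<comment> \<open>The factor \<open>Suc K\<close> is the margin, in units of \<open>d\<close>,
    that \<open>smooth_max_dominant\<close> asks for with the indices up to
    \<open>K\<close>.\<close>
  ultimately obtain d where d: "d > 0"
    "\<forall>p\<in>?S. d * real (Suc K) < (case p of (i, j) \<Rightarrow> fv i - a j (x i))"
    using finite_uniform_scale[of ?S _ "\<lambda>_. real (Suc K)"] by blast
  have self: "a i (x i) = fv i" for i
    by (simp add: a_def ip_linear)
  have grad: "is_grad n (a i) y (g i)" if "i \<le> K" for i y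
    unfolding a_def by (rule is_grad_affine[OF R[OF that]])
  have "smooth_max d a K (x i) = a i (x i) \<and> is_grad n (smooth_max d a K) (x i) (g i)"
    if i: "i \<le> K" for i
  proof (rule smooth_max_dominant[OF d(1) i])
    fix j assume "j \<le> K" "j \<noteq> i"
    then show "a j (x i) + real (Suc K) * d \<le> a i (x i)"
      using d(2)[rule_format, of "(i, j)"] i by (simp add: self mult.commute)
  qed (rule grad)
  moreover have "cvx n (smooth_max d a K)"
    by (intro cvx_smooth_max d) (simp add: a_def cvx_affine)
  moreover have "differentiable_Rn n (smooth_max d a K)"
    unfolding differentiable_Rn_def using smooth_max_has_grad[OF d(1)] grad by blast
  ultimately show ?thesis
    using self by auto
qed

text \<open>Subtracting \<open>m * ip n y y\<close> from the data and its gradient from the slopes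
  lowers the gap of \<open>i\<close> and \<open>j\<close> by exactly \<open>m\<close> times their
  squared distance. A small \<open>m\<close> keeps all gaps positive, and \<open>f\<close>
  interpolates the lowered data.\<close>

lemma smooth_strongly_convex_interpolation:
  fixes K :: nat
  assumes R: "\<And>i. i \<le> K \<Longrightarrow> g i \<in> Rn n \<and> x i \<in> Rn n"
    and gap: "\<And>i j. i \<le> K \<Longrightarrow> j \<le> K \<Longrightarrow> i \<noteq> j \<Longrightarrow> fv i > fv j + ip n (g j) (vsub (x i) (x j))"
  shows "\<exists>f m. m > 0 \<and> cvx n f \<and> differentiable_Rn n f \<and>
    (\<forall>i\<le>K. f (x i) + m * ip n (x i) (x i) = fv i \<and>
       is_grad n (\<lambda>y. f y + m * ip n y y) (x i) (g i))"
proof -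
  let ?S = "{(i, j). i \<le> K \<and> j \<le> K \<and> i \<noteq> j}"
  have "?S \<subseteq> {..K} \<times> {..K}" by auto
  then have "finite ?S" by (rule finite_subset) auto
  moreover have "\<And>p. p \<in> ?S \<Longrightarrow>
      (case p of (i, j) \<Rightarrow> fv i - fv j - ip n (g j) (vsub (x i) (x j))) > 0"
    using gap by fastforce
  ultimately obtain m where m: "m > 0"
    "\<forall>p\<in>?S. m * (case p of (i, j) \<Rightarrow> ip n (vsub (x i) (x j)) (vsub (x i) (x j)))
       < (case p of (i, j) \<Rightarrow> fv i - fv j - ip n (g j) (vsub (x i) (x j)))"
    using finite_uniform_scale[of ?S _ "\<lambda>(i, j). ip n (vsub (x i) (x j)) (vsub (x i) (x j))"] by blast
  define g' where "g' = (\<lambda>i k. g i k - m * (2 * x i k))"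
  define fv' where "fv' = (\<lambda>i. fv i - m * ip n (x i) (x i))"
  have "\<exists>f. cvx n f \<and> differentiable_Rn n f \<and>
      (\<forall>i\<le>K. f (x i) = fv' i \<and> is_grad n f (x i) (g' i))"
  proof (rule smooth_convex_interpolation)
    fix i j assume ij: "i \<le> K" "j \<le> K" "i \<noteq> j"
    have "m * ip n (vsub (x i) (x j)) (vsub (x i) (x j)) < fv i - fv j - ip n (g j) (vsub (x i) (x j))"
      using m(2)[rule_format, of "(i, j)"] ij by simp
    then show "fv' i > fv' j + ip n (g' j) (vsub (x i) (x j))"
      by (simp add: fv'_def g'_def ip_linear ip_commute[of n "x j" "x i"] algebra_simps)
  qed (use R in \<open>auto simp: g'_def intro!: Rn_diff Rn_scale\<close>)
  then obtain f where f: "cvx n f" "differentiable_Rn n f"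
    "\<And>i. i \<le> K \<Longrightarrow> f (x i) = fv' i \<and> is_grad n f (x i) (g' i)" by blast
  have "is_grad n (\<lambda>y. f y + m * ip n y y) (x i) (g i)" if "i \<le> K" for i
  proof -
    have "is_grad n (\<lambda>y. f y + m * ip n y y) (x i) (\<lambda>k. g' i k + m * (2 * x i k))"
      using f(3)[OF that] R[OF that] by (intro is_grad_add is_grad_scale is_grad_ip_self) auto
    then show ?thesis by (simp add: g'_def)
  qed
  then show ?thesis
    using m(1) f by (intro exI[of _ f] exI[of _ m]) (auto simp: fv'_def)
qed

section \<open>Gram matrices\<close>

lemma quadratic_form_insert:
  fixes G :: "'a \<Rightarrow> 'a \<Rightarrow> real"
  assumes "finite J" "a \<notin> J" and sym: "\<And>q. q \<in> J \<Longrightarrow> G q a = G a q"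
  shows "(\<Sum>p\<in>insert a J. \<Sum>q\<in>insert a J. v p * G p q * v q)
    = v a * v a * G a a + 2 * v a * (\<Sum>q\<in>J. G a q * v q) + (\<Sum>p\<in>J. \<Sum>q\<in>J. v p * G p q * v q)"
proof -
  have "(\<Sum>p\<in>J. v p * G p a * v a) = v a * (\<Sum>q\<in>J. G a q * v q)"
    unfolding sum_distrib_left by (rule sum.cong) (auto simp: sym)
  moreover have "(\<Sum>q\<in>J. v a * G a q * v q) = v a * (\<Sum>q\<in>J. G a q * v q)"
    unfolding sum_distrib_left by (rule sum.cong) auto
  ultimately show ?thesis
    using assms by (simp add: sum.distrib)
qed

text \<open>Cholesky elimination of one index at a time. A zero pivot forces its row to vanish and
  receives the zero vector; a positive pivot adds one coordinate and leaves the Schur complement to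
  the induction.\<close>

lemma psd_gram_factorization:
  fixes G :: "'a \<Rightarrow> 'a \<Rightarrow> real"
  assumes "finite J" "\<And>p q. p \<in> J \<Longrightarrow> q \<in> J \<Longrightarrow> G p q = G q p"
    and "\<And>v. (\<Sum>p\<in>J. \<Sum>q\<in>J. v p * G p q * v q) \<ge> 0"
  shows "\<exists>n\<ge>1. \<exists>V. (\<forall>p\<in>J. V p \<in> Rn n) \<and> (\<forall>p\<in>J. \<forall>q\<in>J. G p q = ip n (V p) (V q))"
  using assms
proof (induction J arbitrary: G rule: finite_induct)
  case empty
  then show ?case by auto
next
  case (insert a J)
  note expand = quadratic_form_insert[OF insert.hyps, of G]
  have sym: "\<And>q. q \<in> J \<Longrightarrow> G q a = G a q"
    using insert.prems(1) by simp
  have form: "v a * v a * G a a + 2 * v a * (\<Sum>q\<in>J. G a q * v q)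
      + (\<Sum>p\<in>J. \<Sum>q\<in>J. v p * G p q * v q) \<ge> 0" for v
    using insert.prems(2)[of v] expand[OF sym] by simp
  have upd: "(\<Sum>q\<in>J. G a q * (v(a := c)) q) = (\<Sum>q\<in>J. G a q * v q)"
    "(\<Sum>p\<in>J. \<Sum>q\<in>J. (v(a := c)) p * G p q * (v(a := c)) q) = (\<Sum>p\<in>J. \<Sum>q\<in>J. v p * G p q * v q)"
    for v and c :: real
    using insert.hyps by (auto intro!: sum.cong)
  \<comment> \<open>The coefficient at \<open>a\<close> becomes a scalar \<open>c\<close> that can
    be chosen freely for each \<open>v\<close>.\<close>
  have form': "c * c * G a a + 2 * c * (\<Sum>q\<in>J. G a q * v q)
      + (\<Sum>p\<in>J. \<Sum>q\<in>J. v p * G p q * v q) \<ge> 0" for v c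
    using form[of "v(a := c)"] unfolding upd by simp
  have diag: "G a a \<ge> 0"
    using form'[of 1 "\<lambda>_. 0"] by simp
  show ?case
  proof (cases "G a a = 0")
    case True
    have zero: "G a q = 0" if q: "q \<in> J" for q
    proof (rule ccontr)
      assume nz: "G a q \<noteq> 0"
      define v :: "'a \<Rightarrow> real" where "v = (\<lambda>p. if p = q then 1 else 0)"
      \<comment> \<open>With a zero pivot the form is affine in \<open>c\<close>, and this value
        makes it \<open>-1\<close>.\<close>
      define c where "c = - (G q q + 1) / (2 * G a q)"
      have sum_v: "(\<Sum>p\<in>J. w p * v p) = w q" for w
      proof -
        have "(\<Sum>p\<in>J. w p * v p) = (\<Sum>p\<in>J. if p = q then w q else 0)"
          by (intro sum.cong) (auto simp: v_def)
        then show ?thesis using q insert.hyps by simp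
      qed
      have "(\<Sum>p\<in>J. \<Sum>q\<in>J. v p * G p q * v q) = G q q"
        unfolding sum_v using sum_v[of "\<lambda>p. G p q"] by (simp add: mult.commute)
      then have "2 * c * G a q + G q q \<ge> 0"
        using form'[of c v] True sum_v[of "G a"] by simp
      moreover have "2 * c * G a q = - (G q q + 1)"
        using nz by (simp add: c_def)
      ultimately show False by simp
    qed
    have "\<exists>n\<ge>1. \<exists>V. (\<forall>p\<in>J. V p \<in> Rn n) \<and> (\<forall>p\<in>J. \<forall>q\<in>J. G p q = ip n (V p) (V q))"
      using form'[of 0] by (intro insert.IH) (auto simp: insert.prems(1))
    then obtain n V where V: "n \<ge> 1" "\<And>p. p \<in> J \<Longrightarrow> V p \<in> Rn n"
      "\<And>p q. p \<in> J \<Longrightarrow> q \<in> J \<Longrightarrow> G p q = ip n (V p) (V q)" by metis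
    define V' where "V' = V(a := vzero)"
    have V': "V' p = V p" if "p \<in> J" for p
      using that insert.hyps by (auto simp: V'_def)
    have V'a: "V' a = vzero" by (simp add: V'_def)
    have "(\<forall>p\<in>insert a J. V' p \<in> Rn n) \<and>
        (\<forall>p\<in>insert a J. \<forall>q\<in>insert a J. G p q = ip n (V' p) (V' q))"
      by (simp add: V' V'a V zero sym True)
    then show ?thesis using V(1) by blast
  next
    case False
    then have pos: "G a a > 0" using diag by simp
    define G' where "G' = (\<lambda>p q. G p q - G a p * G a q / G a a)"
    have psd: "(\<Sum>p\<in>J. \<Sum>q\<in>J. v p * G' p q * v q) \<ge> 0" for v
    proof -
      define S where "S = (\<Sum>q\<in>J. G a q * v q)"
      have "(\<Sum>p\<in>J. \<Sum>q\<in>J. v p * (G a p * G a q / G a a) * v q) = S * S / G a a"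
        unfolding S_def sum_product sum_divide_distrib by (intro sum.cong) auto
      then have eq: "(\<Sum>p\<in>J. \<Sum>q\<in>J. v p * G' p q * v q)
          = (\<Sum>p\<in>J. \<Sum>q\<in>J. v p * G p q * v q) - S * S / G a a"
        by (simp add: G'_def algebra_simps sum_subtractf)
      \<comment> \<open>The scalar \<open>c = - S / G a a\<close> minimizes the form, and the
        minimum is the form of the Schur complement \<open>G'\<close>.\<close>
      have "(- S / G a a) * (- S / G a a) * G a a + 2 * (- S / G a a) * S = - (S * S / G a a)"
        using pos by (simp add: field_simps)
      then show ?thesis
        using form'[of "- S / G a a" v] unfolding S_def[symmetric] eq by simp
    qed
    have "\<exists>n\<ge>1. \<exists>V. (\<forall>p\<in>J. V p \<in> Rn n) \<and> (\<forall>p\<in>J. \<forall>q\<in>J. G' p q = ip n (V p) (V q))"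
    proof (rule insert.IH)
      fix p q assume "p \<in> J" "q \<in> J"
      then show "G' p q = G' q p"
        using insert.prems(1)[of p q] by (simp add: G'_def mult.commute)
    qed (rule psd)
    then obtain n V where V: "n \<ge> 1" "\<And>p. p \<in> J \<Longrightarrow> V p \<in> Rn n"
      "\<And>p q. p \<in> J \<Longrightarrow> q \<in> J \<Longrightarrow> G' p q = ip n (V p) (V q)" by metis
    \<comment> \<open>Coordinate \<open>n\<close> is invisible to \<open>ip n\<close>. The products
      of the new entries restore the term subtracted in \<open>G'\<close> and the row of
      \<open>a\<close>.\<close>
    define V' where "V' = (\<lambda>p. if p = a then vzero(n := sqrt (G a a)) else (V p)(n := G a p / sqrt (G a a)))"
    have sq: "sqrt (G a a) * sqrt (G a a) = G a a" "sqrt (G a a) \<noteq> 0"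
      using pos by auto
    have ip': "ip (Suc n) (x(n := b)) (y(n := c)) = ip n x y + b * c" for x y b c
      by (simp add: ip_def)
    have Rn': "x \<in> Rn n \<Longrightarrow> x(n := b) \<in> Rn (Suc n)" for x b
      by (auto simp: Rn_def)
    have V': "V' p = (V p)(n := G a p / sqrt (G a a))" if "p \<in> J" for p
      using that insert.hyps by (auto simp: V'_def)
    have V'a: "V' a = vzero(n := sqrt (G a a))" by (simp add: V'_def)
    have "G p q = ip (Suc n) (V' p) (V' q)" if "p \<in> J" "q \<in> J" for p q
      using that pos V(3)[of p q] by (simp add: V' ip' G'_def sq)
    moreover have "G a q = ip (Suc n) (V' a) (V' q)" "G q a = ip (Suc n) (V' q) (V' a)" if "q \<in> J" for q
      using that pos by (simp_all add: V' V'a ip' sq sym)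
    moreover have "G a a = ip (Suc n) (V' a) (V' a)"
      using pos by (simp add: V'a ip' sq)
    moreover have "V' p \<in> Rn (Suc n)" if "p \<in> insert a J" for p
    proof (cases "p = a")
      case True
      then show ?thesis using Rn'[OF Rn_zero] by (simp add: V'a)
    next
      case False
      then have "p \<in> J" using that by simp
      then show ?thesis using Rn'[OF V(2)] by (simp add: V')
    qed
    ultimately have "(\<forall>p\<in>insert a J. V' p \<in> Rn (Suc n)) \<and>
        (\<forall>p\<in>insert a J. \<forall>q\<in>insert a J. G p q = ip (Suc n) (V' p) (V' q))"
      by simp
    moreover have "Suc n \<ge> 1" by simp
    ultimately show ?thesis by blast
  qed
qed

text \<open>The form is the squared norm of the combination \<open>w\<close> of the vectors
  \<open>V p\<close>.\<close>

lemma gram_psd: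
  "(\<Sum>p\<in>J. \<Sum>q\<in>J. v p * ip n (V p) (V q) * v q) \<ge> 0"
proof -
  define w where "w = (\<lambda>k. \<Sum>p\<in>J. v p * V p k)"
  have "ip n w w = (\<Sum>k<n. \<Sum>p\<in>J. \<Sum>q\<in>J. v p * (V p k * V q k) * v q)"
    unfolding ip_def w_def sum_product by (intro sum.cong) auto
  also have "\<dots> = (\<Sum>p\<in>J. \<Sum>q\<in>J. v p * ip n (V p) (V q) * v q)"
    unfolding ip_def sum_distrib_left sum_distrib_right
    by (subst sum.swap, intro sum.cong refl, subst sum.swap) (rule refl)
  finally show ?thesis
    using ip_self_nonneg[of n w] by simp
qed

section \<open>From the worst-case problem to its relaxation\<close>

lemma PEPbar_feasibleI:
  assumes cv: "cvx n f" "cvx n h" "cvx n (\<lambda>y. L * h y - f y)"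
    and x: "\<And>i. i \<in> Iset N \<Longrightarrow> x i \<in> Rn n"
    and gr: "\<And>i. i \<in> Iset N \<Longrightarrow> is_grad n f (x i) (g i)" "\<And>i. i \<in> Iset N \<Longrightarrow> is_grad n h (x i) (s i)"
    and "g (star N) = vzero" "\<And>i. i < N \<Longrightarrow> s (Suc i) = (\<lambda>k. s i k - lam * g i k)"
    and "h (x (star N)) - h (x 0) - ip n (s 0) (vsub (x (star N)) (x 0)) = 1"
  shows "PEPbar_feasible N L lam n x (\<lambda>i. f (x i)) g (\<lambda>i. h (x i)) s"
proof -
  have "is_grad n (\<lambda>y. L * h y - f y) (x i) (\<lambda>k. L * s i k - g i k)" if "i \<in> Iset N" for i
    by (intro is_grad_diff is_grad_scale gr that)
  then show ?thesis
    unfolding PEPbar_feasible_def using assms is_grad_Rn[OF gr(1)] is_grad_Rn[OF gr(2)]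
    by (intro conjI exI[of _ f] exI[of _ h] ballI cvx_is_grad_imp_subgrad allI impI) auto
qed

text \<open>Covers the quotients of \<open>PEP_val\<close> with denominator 0, which evaluate to 0.
  The witness is \<open>f = 0\<close> and \<open>h\<close> the square on the real line, with all
  iterates at 0 and the minimizer at 1.\<close>

lemma PEPbar_val_nonneg: "0 \<le> PEPbar_val N L lam" if L: "L > 0"
proof -
  define x :: "nat \<Rightarrow> vect" where "x = (\<lambda>i k. if k = 0 \<and> i = Suc N then 1 else 0)"
  have "cvx 1 (\<lambda>y. 0 + 1 * ip 1 y y)"
    by (rule strict_cvx_imp_cvx[OF strict_cvx_cvx_add_square]) (auto simp: cvx_def)
  then have c: "cvx 1 (\<lambda>y. ip 1 y y)" by simp
  have x: "x i \<in> Rn 1" for i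
    by (auto simp: x_def Rn_def)
  have "PEPbar_feasible N L lam 1 x (\<lambda>i. (\<lambda>_. 0) (x i)) (\<lambda>_. vzero) (\<lambda>i. ip 1 (x i) (x i)) (\<lambda>i k. 2 * x i k)"
  proof (rule PEPbar_feasibleI)
    show "cvx 1 (\<lambda>y. L * ip 1 y y - 0)"
      using cvx_scale[OF c, of L] L by simp
    show "is_grad 1 (\<lambda>_. 0) (x i) vzero" for i
      using is_grad_affine[of vzero 1 0] by simp
    show "ip 1 (x (star N)) (x (star N)) - ip 1 (x 0) (x 0)
        - ip 1 (\<lambda>k. 2 * x 0 k) (vsub (x (star N)) (x 0)) = 1"
      by (simp add: ip_def x_def star_def vsub_def)
    show "is_grad 1 (\<lambda>y. ip 1 y y) (x i) (\<lambda>k. 2 * x i k)" for i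
      by (rule is_grad_ip_self[OF x])
    show "(\<lambda>k. 2 * x (Suc i) k) = (\<lambda>k. 2 * x i k - lam * vzero k)" if "i < N" for i
      using that by (simp add: x_def vzero_def)
  qed (use c x in \<open>simp_all add: cvx_def\<close>)
  then have "\<exists>n x fv g hv s. ereal 0 = ereal (fv N - fv (star N)) \<and> n \<ge> 1 \<and>
      PEPbar_feasible N L lam n x fv g hv s"
    by (intro exI[of _ 1] exI[of _ x] exI[of _ "\<lambda>_. 0"] exI[of _ "\<lambda>_. vzero"]
        exI[of _ "\<lambda>i. ip 1 (x i) (x i)"] exI[of _ "\<lambda>i k. 2 * x i k"]) simp
  then have "ereal 0 \<le> PEPbar_val N L lam"
    unfolding PEPbar_val_def by (intro Sup_upper) blast
  then show ?thesis by (simp add: zero_ereal_def)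
qed

text \<open>The objective has gradient \<open>p + (1 / lam) * (grad h u - grad h x)\<close> at
  \<open>u\<close>, which must vanish at a minimizer.\<close>

lemma Bregman_prox_grad:
  assumes h: "differentiable_Rn n h" and lam: "lam > 0" and x: "x \<in> Rn n" and p: "p \<in> Rn n"
    and u: "is_minimizer n (\<lambda>u. ip n p (vsub u x) + (1 / lam) * Dh n h u x) u"
  shows "grad n h u = (\<lambda>k. grad n h x k - lam * p k)"
proof -
  have uR: "u \<in> Rn n" using u by (simp add: is_minimizer_def)
  have gx: "grad n h x \<in> Rn n" using is_grad_Rn[OF is_grad_grad[OF h x]] .
  have "is_grad n (\<lambda>u. (0 + ip n p (vsub u x))
      + (1 / lam) * (h u - (h x + ip n (grad n h x) (vsub u x)))) u
      (\<lambda>k. p k + (1 / lam) * (grad n h u k - grad n h x k))"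
    by (intro is_grad_add is_grad_affine is_grad_scale is_grad_diff is_grad_grad h uR p gx)
  then have "is_grad n (\<lambda>u. ip n p (vsub u x) + (1 / lam) * Dh n h u x) u
      (\<lambda>k. p k + (1 / lam) * (grad n h u k - grad n h x k))"
    by (simp add: Dh_def diff_diff_add)
  from is_minimizer_grad_0[OF this u]
  have "p k + (1 / lam) * (grad n h u k - grad n h x k) = 0" for k
    by (simp add: vzero_def fun_eq_iff)
  then show ?thesis
    using lam by (auto simp: fun_eq_iff field_simps)
qed

text \<open>The unique-existence clause of \<open>BL\<close> gives the \<open>THE\<close> in
  \<open>nolips\<close> its meaning. It applies only at points of \<open>Rn n\<close>, so membership
  has to be carried through the induction.\<close>

lemma nolips_Rn_grad:
  assumes B: "BL n L f h" and lam: "lam > 0" and x0: "x0 \<in> Rn n"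
  shows "nolips n lam f h x0 k \<in> Rn n"
    and "grad n h (nolips n lam f h x0 (Suc k))
      = (\<lambda>i. grad n h (nolips n lam f h x0 k) i - lam * grad n f (nolips n lam f h x0 k) i)"
proof -
  have diff: "differentiable_Rn n f" "differentiable_Rn n h"
    using B by (auto simp: BL_def)
  let ?\<Phi> = "\<lambda>x u. ip n (grad n f x) (vsub u x) + (1 / lam) * Dh n h u x"
  have ex1: "\<exists>!u. is_minimizer n (?\<Phi> x) u" if x: "x \<in> Rn n" for x
    using B lam x is_grad_Rn[OF is_grad_grad[OF diff(1) x]] unfolding BL_def by blast
  have step: "is_minimizer n (?\<Phi> x) (THE u. is_minimizer n (?\<Phi> x) u)" if "x \<in> Rn n" for x
    using theI'[OF ex1[OF that]] .
  show R: "nolips n lam f h x0 k \<in> Rn n"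
  proof (induction k)
    case (Suc k)
    then show ?case using step by (simp add: is_minimizer_def)
  qed (simp add: x0)
  show "grad n h (nolips n lam f h x0 (Suc k))
      = (\<lambda>i. grad n h (nolips n lam f h x0 k) i - lam * grad n f (nolips n lam f h x0 k) i)"
    unfolding nolips.simps
    by (rule Bregman_prox_grad[OF diff(2) lam R is_grad_Rn[OF is_grad_grad[OF diff(1) R]] step[OF R]])
qed

lemma PEP_le_PEPbar:
  assumes L: "L > 0" and lam: "lam > 0"
  shows "PEP_val N L lam \<le> PEPbar_val N L lam"
  unfolding PEP_val_def
proof (rule Sup_least)
  fix e assume "e \<in> {ereal ((f (nolips n lam f h x0 N) - f xs) / Dh n h xs x0) | n f h x0 xs.
       n \<ge> 1 \<and> BL n L f h \<and> x0 \<in> Rn n \<and> is_minimizer n f xs}"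
  then obtain n f h x0 xs where e: "e = ereal ((f (nolips n lam f h x0 N) - f xs) / Dh n h xs x0)"
    and n: "n \<ge> 1" and B: "BL n L f h" and x0: "x0 \<in> Rn n" and xs: "is_minimizer n f xs"
    by blast
  \<comment> \<open>Dividing \<open>f\<close> and \<open>h\<close> by the same \<open>D\<close>
    preserves the step relation and the convexity of \<open>L h - f\<close>, makes the Bregman
    distance 1 and turns the quotient into a plain difference.\<close>
  define D where "D = Dh n h xs x0"
  \<comment> \<open>Slot \<open>Suc N\<close> holds the minimizer instead of a further iterate; the
    recursion for \<open>s\<close> ends at index \<open>N\<close> and does not reach it.\<close>
  define x where "x = (\<lambda>i. if i = Suc N then xs else nolips n lam f h x0 i)"
  define g where "g = (\<lambda>i k. 1 / D * grad n f (x i) k)"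
  define s where "s = (\<lambda>i k. 1 / D * grad n h (x i) k)"
  have diff: "differentiable_Rn n f" "differentiable_Rn n h"
    and cv: "cvx n f" "cvx n h" "cvx n (\<lambda>y. L * h y - f y)"
    using B strict_cvx_imp_cvx by (auto simp: BL_def)
  have xsR: "xs \<in> Rn n" using xs by (simp add: is_minimizer_def)
  have x: "x i \<in> Rn n" for i
    using nolips_Rn_grad(1)[OF B lam x0] xsR by (simp add: x_def)
  have "D \<ge> 0"
    using cvx_is_grad_imp_subgrad[OF cv(2) is_grad_grad[OF diff(2) x0] x0] xsR
    by (auto simp: subgrad_def D_def Dh_def algebra_simps)
  then consider "D = 0" | "D > 0" by linarith
  then show "e \<le> PEPbar_val N L lam"
  proof cases
    case 1
    then show ?thesis
      using PEPbar_val_nonneg[OF L] e by (simp add: D_def zero_ereal_def)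
  next
    case 2
    have "PEPbar_feasible N L lam n x (\<lambda>i. 1 / D * f (x i)) g (\<lambda>i. 1 / D * h (x i)) s"
    proof (rule PEPbar_feasibleI)
      show "cvx n (\<lambda>y. 1 / D * f y)" "cvx n (\<lambda>y. 1 / D * h y)"
        using 2 by (intro cvx_scale cv; simp)+
      have "cvx n (\<lambda>y. 1 / D * (L * h y - f y))"
        using 2 cv by (intro cvx_scale) auto
      then show "cvx n (\<lambda>y. L * (1 / D * h y) - 1 / D * f y)"
        by (simp add: algebra_simps diff_divide_distrib)
      show "is_grad n (\<lambda>y. 1 / D * f y) (x i) (g i)" "is_grad n (\<lambda>y. 1 / D * h y) (x i) (s i)" for i
        unfolding g_def s_def by (intro is_grad_scale is_grad_grad diff x)+
      have "grad n f xs = vzero"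
        using is_minimizer_grad_0[OF is_grad_grad[OF diff(1) xsR] xs] .
      then show "g (star N) = vzero"
        by (simp add: g_def x_def star_def vzero_def)
      show "s (Suc i) = (\<lambda>k. s i k - lam * g i k)" if "i < N" for i
        using that nolips_Rn_grad(2)[OF B lam x0, of i] unfolding s_def g_def x_def
        by (simp add: diff_divide_distrib del: nolips.simps)
      have "1 / D * h xs - 1 / D * h x0 - ip n (\<lambda>k. 1 / D * grad n h x0 k) (vsub xs x0) = 1 / D * D"
        unfolding ip_scale_left by (simp only: D_def Dh_def right_diff_distrib)
      then show "1 / D * h (x (star N)) - 1 / D * h (x 0) - ip n (s 0) (vsub (x (star N)) (x 0)) = 1"
        using 2 by (simp add: x_def s_def star_def)
    qed (rule x)
    moreover have "e = ereal (1 / D * f (x N) - 1 / D * f (x (star N)))"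
      unfolding e by (simp add: x_def star_def D_def diff_divide_distrib)
    ultimately show ?thesis
      unfolding PEPbar_val_def using n
      by (intro Sup_upper CollectI exI[of _ n] exI[of _ x] exI[of _ "\<lambda>i. 1 / D * f (x i)"] exI[of _ g]
          exI[of _ "\<lambda>i. 1 / D * h (x i)"] exI[of _ s]) simp
  qed
qed

lemma PEPbar_le_SDP: "PEPbar_val N L lam \<le> SDP_val N L lam"
  unfolding PEPbar_val_def
proof (rule Sup_least)
  fix e assume "e \<in> {ereal (fv N - fv (star N)) | n x fv g hv s.
       n \<ge> 1 \<and> PEPbar_feasible N L lam n x fv g hv s}"
  then obtain n x fv g hv s where e: "e = ereal (fv N - fv (star N))"
    and P: "PEPbar_feasible N L lam n x fv g hv s" by blast
  define V where "V = (\<lambda>(a, i). case a of BX \<Rightarrow> x i | BG \<Rightarrow> g i | BS \<Rightarrow> s i)"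
  define G where "G = (\<lambda>p q. ip n (V p) (V q))"
  have V: "V (BX, i) = x i" "V (BG, i) = g i" "V (BS, i) = s i" for i
    by (simp_all add: V_def)
  from P obtain F H where FH: "\<And>i. i \<in> Iset N \<Longrightarrow> fv i = F (x i) \<and> subgrad n F (x i) (g i) \<and>
      hv i = H (x i) \<and> subgrad n (\<lambda>y. L * H y - F y) (x i) (\<lambda>k. L * s i k - g i k)"
    unfolding PEPbar_feasible_def by blast
  have R: "i \<in> Iset N \<Longrightarrow> x i \<in> Rn n" for i
    using P by (simp add: PEPbar_feasible_def)
  have "SDP_feasible N L lam fv hv G"
    unfolding SDP_feasible_def
  proof (intro conjI ballI allI impI)
    show "sym_psd N G"
      unfolding sym_psd_def G_def using gram_psd by (auto intro: ip_commute)
    show "G (BG, star N) (BG, star N) = 0"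
      using P by (simp add: G_def V PEPbar_feasible_def)
    show "G (BS, Suc i) (BX, j) = G (BS, i) (BX, j) - lam * G (BG, i) (BX, j)" if "i < N" for i j
      using P that by (simp add: G_def V PEPbar_feasible_def ip_linear)
    show "hv (star N) - hv 0 - G (BS, 0) (BX, star N) + G (BS, 0) (BX, 0) = 1"
      using P by (simp add: G_def V PEPbar_feasible_def ip_linear)
    fix i j assume ij: "i \<in> Iset N" "j \<in> Iset N"
    have "F (x i) \<ge> F (x j) + ip n (g j) (vsub (x i) (x j))"
      "L * H (x i) - F (x i) \<ge> L * H (x j) - F (x j) + ip n (\<lambda>k. L * s j k - g j k) (vsub (x i) (x j))"
      using FH[OF ij(2)] R[OF ij(1)] unfolding subgrad_def by blast+
    then show "fv i - fv j - G (BG, j) (BX, i) + G (BG, j) (BX, j) \<ge> 0"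
      "(L * hv i - fv i) - (L * hv j - fv j) - L * (G (BS, j) (BX, i) - G (BS, j) (BX, j))
          + G (BG, j) (BX, i) - G (BG, j) (BX, j) \<ge> 0"
      using FH[OF ij(1)] FH[OF ij(2)] by (simp_all add: G_def V ip_linear algebra_simps)
  qed
  then show "e \<le> SDP_val N L lam"
    unfolding SDP_val_def e by (intro Sup_upper) blast
qed

section \<open>From the semidefinite program back to the worst-case problem\<close>

text \<open>Converse of \<open>Bregman_prox_grad\<close>: for convex \<open>h\<close>, the tangent
  inequality at \<open>u\<close> divided by \<open>lam\<close> is, after rearrangement, the
  minimality of \<open>u\<close>.\<close>

lemma Bregman_prox_minimizer:
  assumes h: "cvx n h" "is_grad n h x s" "is_grad n h u (\<lambda>k. s k - lam * p k)"
    and lam: "lam > 0" and x: "x \<in> Rn n" and u: "u \<in> Rn n"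
  shows "is_minimizer n (\<lambda>u. ip n p (vsub u x) + (1 / lam) * Dh n h u x) u"
  unfolding is_minimizer_def
proof (intro conjI u ballI)
  fix y assume y: "y \<in> Rn n"
  have "h y \<ge> h u + ip n (\<lambda>k. s k - lam * p k) (vsub y u)"
    using cvx_is_grad_imp_subgrad[OF h(1) h(3) u] y by (auto simp: subgrad_def)
  then have "1 / lam * (h y - h u - ip n s (vsub y u) + lam * ip n p (vsub y u)) \<ge> 0"
    using lam unfolding ip_diff_left ip_scale_left by simp
  then have "1 / lam * (h y - h u - ip n s (vsub y u)) + ip n p (vsub y u) \<ge> 0"
    using lam by (simp add: distrib_left)
  then show "ip n p (vsub u x) + 1 / lam * Dh n h u x \<le> ip n p (vsub y x) + 1 / lam * Dh n h y x"
    unfolding Dh_def grad_eq[OF h(2) x]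
    by (simp add: ip_linear algebra_simps add_divide_distrib diff_divide_distrib)
qed

text \<open>A strict point is realized without loss: the constructed instance runs through the
  factored nodes and has Bregman distance 1, so its quotient is exactly the objective value.\<close>

lemma strict_SDP_point_le_PEP:
  assumes L: "L > 0" and lam: "lam > 0" and S: "SDP_feasible N L lam F H G"
    and strict: "\<And>i j. i \<in> Iset N \<Longrightarrow> j \<in> Iset N \<Longrightarrow> i \<noteq> j \<Longrightarrow>
        F i - F j - G (BG, j) (BX, i) + G (BG, j) (BX, j) > 0 \<and>
        (L * H i - F i) - (L * H j - F j) - L * (G (BS, j) (BX, i) - G (BS, j) (BX, j))
          + G (BG, j) (BX, i) - G (BG, j) (BX, j) > 0"
  shows "ereal (F N - F (star N)) \<le> PEP_val N L lam"
proof -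
  have fin: "finite (Jset N)" by (simp add: Jset_def Iset_def)
  have "\<exists>n\<ge>1. \<exists>V. (\<forall>p\<in>Jset N. V p \<in> Rn n) \<and>
      (\<forall>p\<in>Jset N. \<forall>q\<in>Jset N. G p q = ip n (V p) (V q))"
    by (rule psd_gram_factorization[OF fin])
      (use S in \<open>auto simp: SDP_feasible_def sym_psd_def\<close>)
  then obtain n V where n: "n \<ge> 1" and VR: "\<And>p. p \<in> Jset N \<Longrightarrow> V p \<in> Rn n"
    and GV: "\<And>p q. p \<in> Jset N \<Longrightarrow> q \<in> Jset N \<Longrightarrow> G p q = ip n (V p) (V q)" by metis
  have J: "(a, i) \<in> Jset N \<longleftrightarrow> i \<in> Iset N" for a i
    by (cases a) (auto simp: Jset_def)
  have I: "i \<in> Iset N \<longleftrightarrow> i \<le> Suc N" for i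
    by (auto simp: Iset_def)
  define x where "x = (\<lambda>i. V (BX, i))"
  define g where "g = (\<lambda>i. V (BG, i))"
  \<comment> \<open>(SDP) fixes the recursion for \<open>s\<close> only up to vectors orthogonal to all \<open>x j\<close>, so \<open>s\<close> is
    rebuilt from \<open>s 0\<close>; its inner products with the \<open>x j\<close> do not change.\<close>
  define s where "s = (\<lambda>i k. if i \<le> N then V (BS, 0) k - lam * (\<Sum>j<i. g j k) else V (BS, i) k)"
  have xR: "x i \<in> Rn n" and gR: "g i \<in> Rn n" if "i \<le> Suc N" for i
    using that VR J I by (simp_all add: x_def g_def)
  have s_Suc: "s (Suc i) = (\<lambda>k. s i k - lam * g i k)" if "i < N" for i
    using that by (auto simp: s_def algebra_simps)
  have s_0: "s 0 = V (BS, 0)" and s_star: "s (Suc N) = V (BS, Suc N)"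
    by (auto simp: s_def)
  have s_le: "s i \<in> Rn n \<and> (\<forall>j\<le>Suc N. ip n (s i) (x j) = G (BS, i) (BX, j))" if "i \<le> N" for i
    using that
  proof (induction i)
    case 0
    then show ?case using VR GV J I by (simp add: s_0 x_def)
  next
    case (Suc i)
    have "G (BS, Suc i) (BX, j) = G (BS, i) (BX, j) - lam * G (BG, i) (BX, j)" if "j \<le> Suc N" for j
      using S Suc.prems that I by (auto simp: SDP_feasible_def)
    moreover have "G (BG, i) (BX, j) = ip n (g i) (x j)" if "j \<le> Suc N" for j
      using that Suc.prems GV J I by (simp add: g_def x_def)
    ultimately show ?case
      using Suc gR[of i] by (auto simp: s_Suc ip_linear intro!: Rn_diff Rn_scale)
  qed
  have sR: "s i \<in> Rn n" and sx: "\<And>j. j \<le> Suc N \<Longrightarrow> G (BS, i) (BX, j) = ip n (s i) (x j)"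
    if "i \<le> Suc N" for i
    using that s_le[of i] VR GV J I by (cases "i = Suc N"; simp add: s_star x_def)+
  have gx: "G (BG, i) (BX, j) = ip n (g i) (x j)" if "i \<le> Suc N" "j \<le> Suc N" for i j
    using that GV J I by (simp add: g_def x_def)
  have "ip n (g (star N)) (g (star N)) = 0"
    using S GV J I by (simp add: g_def SDP_feasible_def star_def)
  then have g_star: "g (star N) = vzero"
    using ip_self_eq_0[OF gR] by (simp add: star_def)
  have "\<exists>f. cvx n f \<and> differentiable_Rn n f \<and> (\<forall>i\<le>Suc N. f (x i) = F i \<and> is_grad n f (x i) (g i))"
  proof (rule smooth_convex_interpolation[OF gR])
    fix i j assume ij: "i \<le> Suc N" "j \<le> Suc N" "i \<noteq> j"
    then show "F i > F j + ip n (g j) (vsub (x i) (x j))"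
      using strict[of i j] I by (simp add: gx ip_linear)
  qed
  then obtain f where f: "cvx n f" "differentiable_Rn n f"
    "\<And>i. i \<le> Suc N \<Longrightarrow> f (x i) = F i" "\<And>i. i \<le> Suc N \<Longrightarrow> is_grad n f (x i) (g i)" by blast
  have "\<exists>Q m. m > 0 \<and> cvx n Q \<and> differentiable_Rn n Q \<and>
    (\<forall>i\<le>Suc N. Q (x i) + m * ip n (x i) (x i) = L * H i - F i \<and>
       is_grad n (\<lambda>y. Q y + m * ip n y y) (x i) (\<lambda>k. L * s i k - g i k))"
  proof (rule smooth_strongly_convex_interpolation)
    fix i j assume ij: "i \<le> Suc N" "j \<le> Suc N" "i \<noteq> j"
    then show "L * H i - F i > L * H j - F j + ip n (\<lambda>k. L * s j k - g j k) (vsub (x i) (x j))"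
      using strict[of i j] I by (simp add: gx sx ip_linear algebra_simps)
  qed (auto intro!: Rn_diff Rn_scale sR gR xR)
  then obtain Q m where Q: "m > 0" "cvx n Q" "differentiable_Rn n Q"
    "\<And>i. i \<le> Suc N \<Longrightarrow> Q (x i) + m * ip n (x i) (x i) = L * H i - F i"
    "\<And>i. i \<le> Suc N \<Longrightarrow> is_grad n (\<lambda>y. Q y + m * ip n y y) (x i) (\<lambda>k. L * s i k - g i k)" by blast
  \<comment> \<open>\<open>h\<close> is chosen so that \<open>L * h - f\<close> is exactly the
    second interpolant. Splitting off the square with coefficient \<open>m / L\<close> gives the
    shape that \<open>Bregman_prox_ex1\<close> requires.\<close>
  define P where "P = (\<lambda>y. 1 / L * (f y + Q y))"
  define h where "h = (\<lambda>y. P y + m / L * ip n y y)"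
  have h_alt: "h = (\<lambda>y. 1 / L * (f y + (Q y + m * ip n y y)))"
    by (simp add: h_def P_def add_divide_distrib fun_eq_iff)
  have P: "cvx n P"
    unfolding P_def using L by (intro cvx_scale cvx_add f Q) auto
  have "is_grad n P y (\<lambda>k. 1 / L * (grad n f y k + grad n Q y k))" if "y \<in> Rn n" for y
    unfolding P_def by (intro is_grad_scale is_grad_add is_grad_grad f Q that)
  then have Pd: "differentiable_Rn n P"
    unfolding differentiable_Rn_def by blast
  have mL: "m / L > 0" using Q L by simp
  have h_strict: "strict_cvx n h"
    unfolding h_def by (rule strict_cvx_cvx_add_square[OF P mL])
  have h_cvx: "cvx n h"
    by (rule strict_cvx_imp_cvx[OF h_strict])
  have "is_grad n h y (\<lambda>k. grad n P y k + m / L * (2 * y k))" if "y \<in> Rn n" for y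
    unfolding h_def by (intro is_grad_scale is_grad_add is_grad_grad Pd is_grad_ip_self that)
  then have hd: "differentiable_Rn n h"
    unfolding differentiable_Rn_def by blast
  have hx: "h (x i) = H i" if "i \<le> Suc N" for i
    using Q(4)[OF that] f(3)[OF that] L by (simp add: h_alt)
  have hg: "is_grad n h (x i) (s i)" if "i \<le> Suc N" for i
  proof -
    have "is_grad n h (x i) (\<lambda>k. 1 / L * (g i k + (L * s i k - g i k)))"
      unfolding h_alt by (intro is_grad_scale is_grad_add f Q that)
    then show ?thesis using L by simp
  qed
  have star_min: "is_minimizer n f (x (star N))"
    using cvx_is_grad_imp_subgrad[OF f(1) f(4) xR, of "star N"] xR[of "star N"]
    by (auto simp: is_minimizer_def subgrad_def g_star star_def g_star[unfolded star_def])
  have "(\<lambda>y. L * h y - f y) = (\<lambda>y. Q y + m * ip n y y)"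
    using L by (simp add: h_alt)
  then have "cvx n (\<lambda>y. L * h y - f y)"
    using strict_cvx_imp_cvx[OF strict_cvx_cvx_add_square[OF Q(2,1)]] by simp
  then have BL: "BL n L f h"
    unfolding BL_def using f h_strict hd star_min Bregman_prox_ex1[OF P Pd mL _ h_def] by blast
  have iter: "nolips n lam f h (x 0) k = x k" if "k \<le> N" for k
    using that
  proof (induction k)
    case (Suc k)
    let ?\<Phi> = "\<lambda>u. ip n (g k) (vsub u (x k)) + 1 / lam * Dh n h u (x k)"
    have "is_minimizer n ?\<Phi> (x (Suc k))"
      using hg[of k] hg[of "Suc k"] Suc.prems
      by (intro Bregman_prox_minimizer[OF h_cvx] lam xR) (auto simp: s_Suc)
    moreover have "\<exists>!u. is_minimizer n ?\<Phi> u"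
      using Suc.prems by (intro Bregman_prox_ex1[OF P Pd mL lam h_def] xR gR) auto
    moreover have "grad n f (x k) = g k"
      using Suc.prems by (intro grad_eq f xR) auto
    ultimately show ?case
      using Suc by (simp add: the1_equality)
  qed simp
  have "Dh n h (x (star N)) (x 0) = H (star N) - H 0 - G (BS, 0) (BX, star N) + G (BS, 0) (BX, 0)"
    unfolding Dh_def by (simp add: grad_eq[OF hg xR] hx star_def ip_linear sx)
  then have "Dh n h (x (star N)) (x 0) = 1"
    using S by (simp add: SDP_feasible_def)
  then have "ereal (F N - F (star N))
      = ereal ((f (nolips n lam f h (x 0) N) - f (x (star N))) / Dh n h (x (star N)) (x 0))"
    by (simp add: iter f(3) star_def)
  then show ?thesis
    unfolding PEP_val_def using n BL xR[of 0] star_min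
    by (intro Sup_upper) blast
qed

text \<open>The Slater point comes from \<open>f y = a y\<^sup>2\<close> and \<open>h y = y\<^sup>2\<close> on the real line with
  \<open>0 < a < L\<close> and \<open>a lam < 1\<close>, started at 1: the iterates \<open>(1 - a lam) ^ k\<close> and the minimizer 0
  are pairwise distinct.\<close>

lemma SDP_Slater_point:
  assumes L: "L > 0" and lam: "lam > 0"
  obtains F H G where "SDP_feasible N L lam F H G"
    "\<And>i j. i \<in> Iset N \<Longrightarrow> j \<in> Iset N \<Longrightarrow> i \<noteq> j \<Longrightarrow>
        F i - F j - G (BG, j) (BX, i) + G (BG, j) (BX, j) > 0 \<and>
        (L * H i - F i) - (L * H j - F j) - L * (G (BS, j) (BX, i) - G (BS, j) (BX, j))
          + G (BG, j) (BX, i) - G (BG, j) (BX, j) > 0"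
proof -
  \<comment> \<open>The halves keep \<open>a\<close> strictly below \<open>L\<close> and the
    contraction factor \<open>1 - a * lam\<close> at least 1/2.\<close>
  define a where "a = min (L / 2) (1 / (2 * lam))"
  have a: "0 < a" "a < L"
    using L lam by (auto simp: a_def min_def)
  have "a * lam \<le> 1 / (2 * lam) * lam"
    using lam by (intro mult_right_mono) (auto simp: a_def)
  then have r: "0 < 1 - a * lam" "1 - a * lam < 1"
    using lam a by auto
  define x where "x = (\<lambda>i. if i = Suc N then 0 else (1 - a * lam) ^ i)"
  define w where "w = (\<lambda>(b, i). case b of BX \<Rightarrow> x i | BG \<Rightarrow> 2 * a * x i | BS \<Rightarrow> 2 * x i)"
  \<comment> \<open>In dimension one the Gram matrix is the outer product of the scalars
    \<open>w\<close>.\<close>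
  define G where "G = (\<lambda>p q. w p * w q)"
  have w: "w (BX, i) = x i" "w (BG, i) = 2 * a * x i" "w (BS, i) = 2 * x i" for i
    by (simp_all add: w_def)
  have f_gap: "a * (x i)\<^sup>2 - a * (x j)\<^sup>2 - G (BG, j) (BX, i) + G (BG, j) (BX, j) = a * (x i - x j)\<^sup>2" for i j
    by (simp add: G_def w power2_eq_square algebra_simps)
  have d_gap: "(L * (x i)\<^sup>2 - a * (x i)\<^sup>2) - (L * (x j)\<^sup>2 - a * (x j)\<^sup>2)
      - L * (G (BS, j) (BX, i) - G (BS, j) (BX, j)) + G (BG, j) (BX, i) - G (BG, j) (BX, j)
      = (L - a) * (x i - x j)\<^sup>2" for i j
    by (simp add: G_def w power2_eq_square algebra_simps)
  have inj: "x i \<noteq> x j" if "i \<le> Suc N" "j \<le> Suc N" "i \<noteq> j" for i j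
  proof -
    have "(1 - a * lam) ^ i = (1 - a * lam) ^ j \<longleftrightarrow> i = j"
      using r by (intro power_inject_exp') auto
    then show ?thesis using that r by (auto simp: x_def)
  qed
  have "sym_psd N G"
    unfolding sym_psd_def
  proof (intro conjI ballI allI)
    fix v
    have "(\<Sum>p\<in>Jset N. \<Sum>q\<in>Jset N. v p * G p q * v q) = (\<Sum>p\<in>Jset N. v p * w p) * (\<Sum>p\<in>Jset N. v p * w p)"
      unfolding sum_product by (intro sum.cong) (auto simp: G_def)
    then show "(\<Sum>p\<in>Jset N. \<Sum>q\<in>Jset N. v p * G p q * v q) \<ge> 0" by simp
  qed (simp add: G_def)
  moreover have "G (BS, Suc i) (BX, j) = G (BS, i) (BX, j) - lam * G (BG, i) (BX, j)" if "i < N" for i j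
  proof -
    have x_Suc: "x (Suc i) = x i - lam * a * x i"
      using that by (simp add: x_def algebra_simps)
    show ?thesis
      unfolding G_def w x_Suc by (simp add: algebra_simps)
  qed
  moreover have "(x (star N))\<^sup>2 - (x 0)\<^sup>2 - G (BS, 0) (BX, star N) + G (BS, 0) (BX, 0) = 1"
    "G (BG, star N) (BG, star N) = 0"
    by (simp_all add: G_def w x_def star_def)
  ultimately have "SDP_feasible N L lam (\<lambda>i. a * (x i)\<^sup>2) (\<lambda>i. (x i)\<^sup>2) G"
    unfolding SDP_feasible_def f_gap d_gap using a by simp
  moreover have "a * (x i - x j)\<^sup>2 > 0 \<and> (L - a) * (x i - x j)\<^sup>2 > 0"
    if "i \<in> Iset N" "j \<in> Iset N" "i \<noteq> j" for i j
    using inj[of i j] that a by (auto simp: Iset_def)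
  ultimately show ?thesis
    using that[of "\<lambda>i. a * (x i)\<^sup>2" "\<lambda>i. (x i)\<^sup>2" G] unfolding f_gap d_gap by blast
qed

text \<open>The scalar constraints are affine in \<open>F\<close>, \<open>H\<close> and
  \<open>G\<close>, and for each fixed \<open>v\<close> the quadratic form is linear in
  \<open>G\<close>.\<close>

lemma SDP_feasible_convex:
  assumes S: "SDP_feasible N L lam F H G" and S': "SDP_feasible N L lam F' H' G'"
    and t: "0 \<le> t" "t \<le> 1"
  shows "SDP_feasible N L lam (\<lambda>i. (1 - t) * F i + t * F' i) (\<lambda>i. (1 - t) * H i + t * H' i)
    (\<lambda>p q. (1 - t) * G p q + t * G' p q)"
  unfolding SDP_feasible_def
proof (intro conjI ballI allI impI)
  show "sym_psd N (\<lambda>p q. (1 - t) * G p q + t * G' p q)"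
    unfolding sym_psd_def
  proof (intro conjI ballI allI)
    fix v
    have "(\<Sum>p\<in>Jset N. \<Sum>q\<in>Jset N. v p * ((1 - t) * G p q + t * G' p q) * v q)
        = (1 - t) * (\<Sum>p\<in>Jset N. \<Sum>q\<in>Jset N. v p * G p q * v q)
          + t * (\<Sum>p\<in>Jset N. \<Sum>q\<in>Jset N. v p * G' p q * v q)"
      unfolding sum_distrib_left sum.distrib[symmetric] by (intro sum.cong) (auto simp: algebra_simps)
    then show "(\<Sum>p\<in>Jset N. \<Sum>q\<in>Jset N. v p * ((1 - t) * G p q + t * G' p q) * v q) \<ge> 0"
      using S S' t by (simp add: SDP_feasible_def sym_psd_def)
  next
    fix p q assume "p \<in> Jset N" "q \<in> Jset N"
    then have "G p q = G q p" "G' p q = G' q p"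
      using S S' unfolding SDP_feasible_def sym_psd_def by blast+
    then show "(1 - t) * G p q + t * G' p q = (1 - t) * G q p + t * G' q p" by simp
  qed
  show "(1 - t) * G (BG, star N) (BG, star N) + t * G' (BG, star N) (BG, star N) = 0"
    using S S' by (simp add: SDP_feasible_def)
  show "(1 - t) * G (BS, Suc i) (BX, j) + t * G' (BS, Suc i) (BX, j)
      = (1 - t) * G (BS, i) (BX, j) + t * G' (BS, i) (BX, j)
        - lam * ((1 - t) * G (BG, i) (BX, j) + t * G' (BG, i) (BX, j))"
    if "i < N" "j \<in> Iset N" for i j
  proof -
    have eqs: "G (BS, Suc i) (BX, j) = G (BS, i) (BX, j) - lam * G (BG, i) (BX, j)"
      "G' (BS, Suc i) (BX, j) = G' (BS, i) (BX, j) - lam * G' (BG, i) (BX, j)"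
      using S S' that unfolding SDP_feasible_def by blast+
    show ?thesis unfolding eqs by (simp add: algebra_simps)
  qed
  have "(1 - t) * (H (star N) - H 0 - G (BS, 0) (BX, star N) + G (BS, 0) (BX, 0))
      + t * (H' (star N) - H' 0 - G' (BS, 0) (BX, star N) + G' (BS, 0) (BX, 0)) = (1 - t) * 1 + t * 1"
    using S S' by (simp add: SDP_feasible_def)
  then show "(1 - t) * H (star N) + t * H' (star N) - ((1 - t) * H 0 + t * H' 0)
      - ((1 - t) * G (BS, 0) (BX, star N) + t * G' (BS, 0) (BX, star N))
      + ((1 - t) * G (BS, 0) (BX, 0) + t * G' (BS, 0) (BX, 0)) = 1"
    by (simp add: algebra_simps)
  fix i j assume ij: "i \<in> Iset N" "j \<in> Iset N"
  let ?A = "\<lambda>F G :: blk \<times> nat \<Rightarrow> blk \<times> nat \<Rightarrow> real. F i - F j - G (BG, j) (BX, i) + G (BG, j) (BX, j)"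
  let ?B = "\<lambda>F H G :: blk \<times> nat \<Rightarrow> blk \<times> nat \<Rightarrow> real. (L * H i - F i) - (L * H j - F j)
    - L * (G (BS, j) (BX, i) - G (BS, j) (BX, j)) + G (BG, j) (BX, i) - G (BG, j) (BX, j)"
  have mix: "0 \<le> (1 - t) * b + t * c" if "0 \<le> b" "0 \<le> c" for b c
    using that t by simp
  have AB: "?A F G \<ge> 0" "?A F' G' \<ge> 0" "?B F H G \<ge> 0" "?B F' H' G' \<ge> 0"
    using S S' ij unfolding SDP_feasible_def by blast+
  have "(1 - t) * ?A F G + t * ?A F' G' \<ge> 0" "(1 - t) * ?B F H G + t * ?B F' H' G' \<ge> 0"
    using AB by (blast intro: mix)+
  then show "?A (\<lambda>i. (1 - t) * F i + t * F' i) (\<lambda>p q. (1 - t) * G p q + t * G' p q) \<ge> 0"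
    "?B (\<lambda>i. (1 - t) * F i + t * F' i) (\<lambda>i. (1 - t) * H i + t * H' i)
       (\<lambda>p q. (1 - t) * G p q + t * G' p q) \<ge> 0"
    by (simp_all add: algebra_simps)
qed

lemma SDP_le_PEP:
  assumes L: "L > 0" and lam: "lam > 0"
  shows "SDP_val N L lam \<le> PEP_val N L lam"
  unfolding SDP_val_def
proof (rule Sup_least)
  fix e assume "e \<in> {ereal (F N - F (star N)) | F H G. SDP_feasible N L lam F H G}"
  then obtain F H G where e: "e = ereal (F N - F (star N))" and S: "SDP_feasible N L lam F H G"
    by blast
  obtain F' H' G' where S': "SDP_feasible N L lam F' H' G'"
    and strict: "\<And>i j. i \<in> Iset N \<Longrightarrow> j \<in> Iset N \<Longrightarrow> i \<noteq> j \<Longrightarrow>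
        F' i - F' j - G' (BG, j) (BX, i) + G' (BG, j) (BX, j) > 0 \<and>
        (L * H' i - F' i) - (L * H' j - F' j) - L * (G' (BS, j) (BX, i) - G' (BS, j) (BX, j))
          + G' (BG, j) (BX, i) - G' (BG, j) (BX, j) > 0"
    using SDP_Slater_point[OF L lam] by metis
  let ?v = "\<lambda>t. ((1 - t) * F N + t * F' N) - ((1 - t) * F (star N) + t * F' (star N))"
  have le: "ereal (?v t) \<le> PEP_val N L lam" if t: "0 < t" "t < 1" for t
  proof (rule strict_SDP_point_le_PEP[OF L lam SDP_feasible_convex[OF S S']])
    fix i j assume ij: "i \<in> Iset N" "j \<in> Iset N" "i \<noteq> j"
    let ?A = "\<lambda>F G :: blk \<times> nat \<Rightarrow> blk \<times> nat \<Rightarrow> real. F i - F j - G (BG, j) (BX, i) + G (BG, j) (BX, j)"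
    let ?B = "\<lambda>F H G :: blk \<times> nat \<Rightarrow> blk \<times> nat \<Rightarrow> real. (L * H i - F i) - (L * H j - F j)
      - L * (G (BS, j) (BX, i) - G (BS, j) (BX, j)) + G (BG, j) (BX, i) - G (BG, j) (BX, j)"
    have mix: "0 < (1 - t) * b + t * c" if "0 \<le> b" "0 < c" for b c
      using that t by (intro add_nonneg_pos mult_nonneg_nonneg mult_pos_pos) auto
    have "?A F G \<ge> 0" "?B F H G \<ge> 0"
      using S ij unfolding SDP_feasible_def by blast+
    moreover have "?A F' G' > 0" "?B F' H' G' > 0"
      using strict[OF ij] by blast+
    ultimately have "(1 - t) * ?A F G + t * ?A F' G' > 0" "(1 - t) * ?B F H G + t * ?B F' H' G' > 0"
      by (blast intro: mix)+
    then show "?A (\<lambda>i. (1 - t) * F i + t * F' i) (\<lambda>p q. (1 - t) * G p q + t * G' p q) > 0 \<and>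
      ?B (\<lambda>i. (1 - t) * F i + t * F' i) (\<lambda>i. (1 - t) * H i + t * H' i)
         (\<lambda>p q. (1 - t) * G p q + t * G' p q) > 0"
      by (simp add: algebra_simps)
  qed (use t in auto)
  \<comment> \<open>At \<open>t = 0\<close> the mixture is the given point, which need not be
    strict; its value is bounded only as the limit of the values for \<open>t > 0\<close>.\<close>
  have "(?v \<longlongrightarrow> ?v 0) (at_right 0)"
    by (intro tendsto_intros)
  then have "((\<lambda>t. ereal (?v t)) \<longlongrightarrow> ereal (?v 0)) (at_right 0)"
    by (rule tendsto_ereal)
  moreover have "\<forall>\<^sub>F t in at_right 0. ereal (?v t) \<le> PEP_val N L lam"
    unfolding eventually_at_right_field using le by (intro exI[of _ 1]) auto
  ultimately have "ereal (?v 0) \<le> PEP_val N L lam"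
    by (rule tendsto_upperbound) simp
  then show "e \<le> PEP_val N L lam" by (simp add: e)
qed

theorem theorem4p5:
  fixes N :: nat and L lam :: real
  assumes "N \<ge> 1" and "L > 0" and "lam > 0"
  shows "PEP_val N L lam = PEPbar_val N L lam \<and> PEPbar_val N L lam = SDP_val N L lam"
  using PEP_le_PEPbar[OF assms(2,3), of N] PEPbar_le_SDP[of N L lam] SDP_le_PEP[OF assms(2,3), of N]
  by (meson antisym order_trans)

end
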